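(* Up to homothetic transformations of the domain and/or codomain, the only proper biharmonic quadratic form from $\mathbb{S}^m$ to $\mathbb{S}^3$, $m\geq2$, is the Hopf fibration $\mathbb{S}^3\to\mathbb{S}^2$ followed by the inclusion, that is, the map $$\phi_0:\mathbb{S}^3(\sqrt2)=\{(z^1,z^2)\in\mathbb{C}^2:\ |z^1|^2+|z^2|^2=2\}\to\mathbb{S}^3\subset\mathbb{C}\times\mathbb{R}^2,$$ $$\phi_0(z^1,z^2)=\frac{1}{2\sqrt2}\left(2z^1\overline{z^2},\ |z^1|^2-|z^2|^2,\ |z^1|^2+|z^2|^2\right).$$ In other words, $\phi_0$ is proper biharmonic, and if $m\geq2$ and $\phi:\mathbb{S}^m\to\mathbb{S}^3$ is a proper biharmonic quadratic form, then $m=3$ and $\phi$ coincides with $\phi_0$ up to homothetic transformations of the domain and/or codomain.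
   Context: $\mathbb{S}^m(r)$ is the sphere of radius $r$ in $\mathbb{R}^{m+1}$ with its round metric and $\mathbb{S}^m=\mathbb{S}^m(1)$. A quadratic form from $\mathbb{S}^m$ to $\mathbb{S}^n$ is a non-constant map $\phi:\mathbb{S}^m\to\mathbb{S}^n$ which is the restriction of a map $F:\mathbb{R}^{m+1}\to\mathbb{R}^{n+1}$ all of whose components are homogeneous polynomials of degree $2$ and with $F(\mathbb{S}^m)\subset\mathbb{S}^n$. A homothetic transformation is a diffeomorphism between spheres rescaling the metric by a positive constant (composition of an isometry with a dilation $\mathbb{S}^m(r)\to\mathbb{S}^m(r')$); isometries are included. For a smooth map $\phi:(M,g)\to(N,h)$ between Riemannian manifolds, the tension field is $\tau(\phi)=\operatorname{trace}\nabla d\phi$ and the bitension field is $\tau_2(\phi)=-\Delta\tau(\phi)-\operatorname{trace}R^N(d\phi(\cdot),\tau(\phi))d\phi(\cdot)$, where $\Delta\sigma=-\operatorname{trace}_g\nabla^2\sigma$ is the rough Laplacian on sections of $\phi^{-1}TN$ and $R(X,Y)Z=\nabla_X\nabla_YZ-\nabla_Y\nabla_XZ-\nabla_{[X,Y]}Z$. The map $\phi$ is harmonic if $\tau(\phi)=0$, biharmonic if $\tau_2(\phi)=0$, and proper biharmonic if it is biharmonic and not harmonic. *)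

theory Defs
  imports "HOL-Analysis.Analysis"
begin

text \<open>
  Throughout, \<open>M\<close> and \<open>N\<close> stand for smooth submanifolds of Euclidean spaces with the metrics
  induced from the ambient inner products; \<open>\<S>\<^sup>m(r)\<close> is \<open>sphere 0 r\<close> in a space of dimension
  \<open>m + 1\<close>. A map on \<open>M\<close> is a function on the ambient space of which only the values on \<open>M\<close>
  matter: all derivatives are taken with respect to \<open>at x within M\<close> and are applied to tangent
  vectors only, where they are uniquely determined.
\<close>

section \<open>Smooth maps\<close>

fun Ck_on :: "nat \<Rightarrow> 'a::euclidean_space set \<Rightarrow> ('a \<Rightarrow> 'b::euclidean_space) \<Rightarrow> bool" where
  "Ck_on 0 U f \<longleftrightarrow> continuous_on U f"
| "Ck_on (Suc k) U f \<longleftrightarrow>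
     (\<forall>x\<in>U. f differentiable (at x)) \<and> (\<forall>v. Ck_on k U (\<lambda>x. frechet_derivative f (at x) v))"

definition smooth_map ::
  "'a::euclidean_space set \<Rightarrow> 'b::euclidean_space set \<Rightarrow> ('a \<Rightarrow> 'b) \<Rightarrow> bool" where
  "smooth_map M N \<phi> \<longleftrightarrow> \<phi> ` M \<subseteq> N \<and>
     (\<forall>x\<in>M. \<exists>U g. open U \<and> x \<in> U \<and> (\<forall>k. Ck_on k U g) \<and> (\<forall>y\<in>M \<inter> U. g y = \<phi> y))"

section \<open>Tangent spaces and Levi-Civita connections\<close>

definition tangent_space :: "'a::euclidean_space set \<Rightarrow> 'a \<Rightarrow> 'a set" where
  "tangent_space M x =
     {v. \<exists>\<gamma>::real \<Rightarrow> 'a. \<gamma> 0 = x \<and> (\<forall>t. \<gamma> t \<in> M) \<and> (\<gamma> has_vector_derivative v) (at 0)}"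

definition tangent_proj :: "'a::euclidean_space set \<Rightarrow> 'a \<Rightarrow> 'a \<Rightarrow> 'a" where
  "tangent_proj M x v = closest_point (tangent_space M x) v"

definition deriv_along ::
  "'a::euclidean_space set \<Rightarrow> ('a \<Rightarrow> 'b::euclidean_space) \<Rightarrow> 'a \<Rightarrow> 'a \<Rightarrow> 'b" where
  "deriv_along M f x v = frechet_derivative f (at x within M) v"

text \<open>
  The connection on \<open>\<phi>\<^sup>-\<^sup>1TN\<close> pulled back from the Levi-Civita connection of \<open>N\<close>. By the Gauss
  formula it is the tangential part of the ambient derivative. For \<open>\<phi> = id\<close> it is the
  Levi-Civita connection of \<open>M\<close>.
\<close>
definition pullback_conn ::
  "'a::euclidean_space set \<Rightarrow> 'b::euclidean_space set \<Rightarrow> ('a \<Rightarrow> 'b) \<Rightarrow> 'a \<Rightarrow> 'a \<Rightarrow> ('a \<Rightarrow> 'b) \<Rightarrow> 'b"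
  where "pullback_conn M N \<phi> x u \<sigma> = tangent_proj N (\<phi> x) (deriv_along M \<sigma> x u)"

definition LC_conn :: "'a::euclidean_space set \<Rightarrow> 'a \<Rightarrow> 'a \<Rightarrow> ('a \<Rightarrow> 'a) \<Rightarrow> 'a" where
  "LC_conn M = pullback_conn M M id"

definition lie_bracket ::
  "'a::euclidean_space set \<Rightarrow> ('a \<Rightarrow> 'a) \<Rightarrow> ('a \<Rightarrow> 'a) \<Rightarrow> 'a \<Rightarrow> 'a" where
  "lie_bracket M X Y x = deriv_along M Y x (X x) - deriv_along M X x (Y x)"

text \<open>
  The tensors below are defined through vector fields. Their values on tangent vectors do not
  depend on how these are extended to vector fields; the extension used here is the tangential
  part of the constant ambient field.
\<close>
definition ext_field :: "'a::euclidean_space set \<Rightarrow> 'a \<Rightarrow> 'a \<Rightarrow> 'a" where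
  "ext_field M v = (\<lambda>y. tangent_proj M y v)"

definition curvature_field ::
  "'a::euclidean_space set \<Rightarrow> ('a \<Rightarrow> 'a) \<Rightarrow> ('a \<Rightarrow> 'a) \<Rightarrow> ('a \<Rightarrow> 'a) \<Rightarrow> 'a \<Rightarrow> 'a" where
  "curvature_field N X Y Z p =
     LC_conn N p (X p) (\<lambda>q. LC_conn N q (Y q) Z)
     - LC_conn N p (Y p) (\<lambda>q. LC_conn N q (X q) Z)
     - LC_conn N p (lie_bracket N X Y p) Z"

definition curvature :: "'a::euclidean_space set \<Rightarrow> 'a \<Rightarrow> 'a \<Rightarrow> 'a \<Rightarrow> 'a \<Rightarrow> 'a" where
  "curvature N p u v w = curvature_field N (ext_field N u) (ext_field N v) (ext_field N w) p"

text \<open>The trace of a bilinear map; it does not depend on the orthonormal basis chosen.\<close>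
definition trace_on ::
  "'a::euclidean_space set \<Rightarrow> ('a \<Rightarrow> 'a \<Rightarrow> 'b::euclidean_space) \<Rightarrow> 'b" where
  "trace_on T q =
     (let E = SOME E. pairwise orthogonal E \<and> (\<forall>e\<in>E. norm e = 1) \<and> span E = T
      in \<Sum>e\<in>E. q e e)"

section \<open>Harmonic and biharmonic maps\<close>

text \<open>\<open>(\<nabla>d\<phi>)(u, v) = \<nabla>\<^sup>\<phi>\<^sub>u d\<phi>(V) - d\<phi>(\<nabla>\<^sub>u V)\<close> for a vector field \<open>V\<close> extending \<open>v\<close>.\<close>
definition second_fundamental_form ::
  "'a::euclidean_space set \<Rightarrow> 'b::euclidean_space set \<Rightarrow> ('a \<Rightarrow> 'b) \<Rightarrow> 'a \<Rightarrow> 'a \<Rightarrow> 'a \<Rightarrow> 'b" where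
  "second_fundamental_form M N \<phi> x u v =
     pullback_conn M N \<phi> x u (\<lambda>y. deriv_along M \<phi> y (ext_field M v y))
     - deriv_along M \<phi> x (LC_conn M x u (ext_field M v))"

definition tension ::
  "'a::euclidean_space set \<Rightarrow> 'b::euclidean_space set \<Rightarrow> ('a \<Rightarrow> 'b) \<Rightarrow> 'a \<Rightarrow> 'b" where
  "tension M N \<phi> x = trace_on (tangent_space M x) (second_fundamental_form M N \<phi> x)"

text \<open>\<open>(\<nabla>\<^sup>2\<sigma>)(u, v) = \<nabla>\<^sup>\<phi>\<^sub>u \<nabla>\<^sup>\<phi>\<^sub>V \<sigma> - \<nabla>\<^sup>\<phi>\<^bsub>\<nabla>\<^sub>u V\<^esub> \<sigma>\<close> for a vector field \<open>V\<close> extending \<open>v\<close>.\<close>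
definition second_covariant_deriv ::
  "'a::euclidean_space set \<Rightarrow> 'b::euclidean_space set \<Rightarrow> ('a \<Rightarrow> 'b) \<Rightarrow> ('a \<Rightarrow> 'b) \<Rightarrow>
   'a \<Rightarrow> 'a \<Rightarrow> 'a \<Rightarrow> 'b" where
  "second_covariant_deriv M N \<phi> \<sigma> x u v =
     pullback_conn M N \<phi> x u (\<lambda>y. pullback_conn M N \<phi> y (ext_field M v y) \<sigma>)
     - pullback_conn M N \<phi> x (LC_conn M x u (ext_field M v)) \<sigma>"

definition rough_laplacian ::
  "'a::euclidean_space set \<Rightarrow> 'b::euclidean_space set \<Rightarrow> ('a \<Rightarrow> 'b) \<Rightarrow> ('a \<Rightarrow> 'b) \<Rightarrow> 'a \<Rightarrow> 'b" where
  "rough_laplacian M N \<phi> \<sigma> x =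
     - trace_on (tangent_space M x) (second_covariant_deriv M N \<phi> \<sigma> x)"

definition bitension ::
  "'a::euclidean_space set \<Rightarrow> 'b::euclidean_space set \<Rightarrow> ('a \<Rightarrow> 'b) \<Rightarrow> 'a \<Rightarrow> 'b" where
  "bitension M N \<phi> x =
     - rough_laplacian M N \<phi> (tension M N \<phi>) x
     - trace_on (tangent_space M x)
         (\<lambda>u v. curvature N (\<phi> x) (deriv_along M \<phi> x u) (tension M N \<phi> x) (deriv_along M \<phi> x v))"

definition harmonic_map ::
  "'a::euclidean_space set \<Rightarrow> 'b::euclidean_space set \<Rightarrow> ('a \<Rightarrow> 'b) \<Rightarrow> bool" where
  "harmonic_map M N \<phi> \<longleftrightarrow> smooth_map M N \<phi> \<and> (\<forall>x\<in>M. tension M N \<phi> x = 0)"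

definition biharmonic_map ::
  "'a::euclidean_space set \<Rightarrow> 'b::euclidean_space set \<Rightarrow> ('a \<Rightarrow> 'b) \<Rightarrow> bool" where
  "biharmonic_map M N \<phi> \<longleftrightarrow> smooth_map M N \<phi> \<and> (\<forall>x\<in>M. bitension M N \<phi> x = 0)"

definition proper_biharmonic ::
  "'a::euclidean_space set \<Rightarrow> 'b::euclidean_space set \<Rightarrow> ('a \<Rightarrow> 'b) \<Rightarrow> bool" where
  "proper_biharmonic M N \<phi> \<longleftrightarrow> biharmonic_map M N \<phi> \<and> \<not> harmonic_map M N \<phi>"

section \<open>Homothetic transformations and quadratic forms\<close>

definition homothetic_transformation ::
  "'a::euclidean_space set \<Rightarrow> 'b::euclidean_space set \<Rightarrow> ('a \<Rightarrow> 'b) \<Rightarrow> bool" where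
  "homothetic_transformation M N \<alpha> \<longleftrightarrow>
     smooth_map M N \<alpha> \<and>
     (\<exists>\<beta>. smooth_map N M \<beta> \<and> (\<forall>x\<in>M. \<beta> (\<alpha> x) = x) \<and> (\<forall>y\<in>N. \<alpha> (\<beta> y) = y)) \<and>
     (\<exists>c>0. \<forall>x\<in>M. \<forall>u\<in>tangent_space M x. \<forall>v\<in>tangent_space M x.
        deriv_along M \<alpha> x u \<bullet> deriv_along M \<alpha> x v = c * (u \<bullet> v))"

definition homogeneous_quadratic :: "('a::euclidean_space \<Rightarrow> real) \<Rightarrow> bool" where
  "homogeneous_quadratic f \<longleftrightarrow>
     (\<exists>a. \<forall>x. f x = (\<Sum>i\<in>Basis. \<Sum>j\<in>Basis. a i j * (x \<bullet> i) * (x \<bullet> j)))"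

definition quadratic_form_between_spheres ::
  "('a::euclidean_space \<Rightarrow> 'b::euclidean_space) \<Rightarrow> bool" where
  "quadratic_form_between_spheres \<phi> \<longleftrightarrow>
     \<not> \<phi> constant_on sphere 0 1 \<and>
     (\<exists>F. (\<forall>b\<in>Basis. homogeneous_quadratic (\<lambda>x. F x \<bullet> b)) \<and>
          F ` sphere 0 1 \<subseteq> sphere 0 1 \<and> (\<forall>x\<in>sphere 0 1. \<phi> x = F x))"

section \<open>The Hopf fibration followed by the inclusion\<close>

definition hopf_incl :: "complex \<times> complex \<Rightarrow> complex \<times> real \<times> real" where
  "hopf_incl = (\<lambda>(z1, z2). (1 / (2 * sqrt 2)) *\<^sub>R
     (2 * z1 * cnj z2, (cmod z1)\<^sup>2 - (cmod z2)\<^sup>2, (cmod z1)\<^sup>2 + (cmod z2)\<^sup>2))"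

end

theory Submission
  imports Defs
begin

text \<open>
  Let \<open>F\<close> be a quadratic form on the sphere of radius \<open>r\<close> in a space of dimension \<open>n\<close>, write
  \<open>F x = G x x\<close> with \<open>G\<close> bilinear and symmetric, and let \<open>c\<close> be the Laplacian of \<open>F\<close> on the
  ambient space, which is a constant vector. The tension field of \<open>F\<close> is the tangential part
  \<open>\<tau> = c - (c \<bullet> F) F\<close> of \<open>c\<close>, so that \<open>F\<close> is harmonic if \<open>c = 0\<close>. The bitension field is
  \<open>2 (n / r\<^sup>2 - c \<bullet> F) \<tau> - 2 dF (grad (c \<bullet> F))\<close> (\<open>tension_form\<close>, \<open>bitension_form\<close>). It
  vanishes for the Hopf fibration followed by the inclusion, for which \<open>c \<bullet> F\<close> is the constant
  \<open>n / r\<^sup>2\<close> although \<open>c \<noteq> 0\<close>.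

  Conversely, let \<open>r = 1\<close>, \<open>c \<noteq> 0\<close> and let the bitension field vanish. Suppose that \<open>c \<bullet> F\<close> had
  different maximum and minimum on the sphere. They are attained at orthogonal eigenvectors,
  and on the great circle through these the \<open>c\<close>-component of the equation is a polynomial
  identity whose cubic coefficient does not vanish. Hence \<open>c \<bullet> F\<close> is constant, and its value is
  \<open>n\<close>, with \<open>c \<bullet> c = 2 n\<^sup>2\<close> (\<open>laplacian_component_radial\<close>). Consequently \<open>F\<close> maps into a
  small two-sphere of radius \<open>1 / sqrt 2\<close>, and its rescaled projection to the hyperplane
  orthogonal to \<open>c\<close> is a quadratic form into the unit two-sphere whose Laplacian is zero.

  For such a form the fibre through a point is a great sphere of codimension at most two, and
  the trace condition bounds its dimension from above; this leaves \<open>n = 3\<close> and \<open>n = 4\<close>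
  (\<open>fibre_decomposition\<close>). For \<open>n = 3\<close> there are too few dimensions in the target for the
  vectors \<open>G x y\<close> (\<open>domain_dim_not_3\<close>). For \<open>n = 4\<close> the domain splits into two planes on which
  the form is \<open>\<bar>x\<bar>\<^sup>2 v\<close> and \<open>- \<bar>x\<bar>\<^sup>2 v\<close>, and the mixed part is bilinear and multiplies
  norms. In suitable orthonormal frames it is the product \<open>z\<^sub>1 cnj z\<^sub>2\<close> of the Hopf fibration
  (\<open>hopf_frame\<close>), and the frames define the homotheties.
\<close>

section \<open>Derivatives along tangent vectors\<close>

text \<open>Composing with a curve that realises the tangent vector shows that every derivative of \<open>f\<close>
  within \<open>M\<close> takes the same value on it, in particular the one chosen by \<open>frechet_derivative\<close>.\<close>
lemma deriv_along_eq:
  assumes D: "(f has_derivative D) (at x within M)" and v: "v \<in> tangent_space M x"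
  shows "deriv_along M f x v = D v"
proof -
  obtain \<gamma> :: "real \<Rightarrow> 'a" where \<gamma>: "\<gamma> 0 = x" "\<And>t. \<gamma> t \<in> M"
    "(\<gamma> has_vector_derivative v) (at 0)"
    using v unfolding tangent_space_def by blast
  have along: "(f \<circ> \<gamma> has_vector_derivative L v) (at 0)"
    if L: "(f has_derivative L) (at x within M)" for L
  proof -
    have "(f has_derivative L) (at (\<gamma> 0) within range \<gamma>)"
      using has_derivative_subset[OF L, of "range \<gamma>"] \<gamma> by auto
    moreover have "(\<gamma> has_derivative (\<lambda>t. t *\<^sub>R v)) (at 0 within UNIV)"
      using \<gamma>(3) by (simp add: has_vector_derivative_def)
    ultimately have "(f \<circ> \<gamma> has_derivative (L \<circ> (\<lambda>t. t *\<^sub>R v))) (at 0 within UNIV)"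
      by (intro diff_chain_within)
    moreover have "L \<circ> (\<lambda>t. t *\<^sub>R v) = (\<lambda>t. t *\<^sub>R L v)"
      using has_derivative_linear[OF L] by (auto simp: linear_cmul)
    ultimately show ?thesis by (simp add: has_vector_derivative_def)
  qed
  have "(f has_derivative frechet_derivative f (at x within M)) (at x within M)"
    using D frechet_derivative_works differentiable_def by blast
  then show ?thesis
    unfolding deriv_along_def using along D vector_derivative_unique_at by blast
qed

lemma deriv_along_eq_on:
  assumes "(g has_derivative D) (at x within M)" "v \<in> tangent_space M x" "x \<in> M"
    and "\<And>y. y \<in> M \<Longrightarrow> f y = g y"
  shows "deriv_along M f x v = D v"
  using assms by (intro deriv_along_eq has_derivative_transform[of x M f g D]) auto

section \<open>Round spheres\<close>

lemma tangent_space_sphere: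
  fixes x :: "'a::euclidean_space"
  assumes r: "r > 0" and x: "norm x = r"
  shows "tangent_space (sphere 0 r) x = {v. v \<bullet> x = 0}"
proof (intro equalityI subsetI; clarify)
  fix v assume "v \<in> tangent_space (sphere 0 r) x"
  then obtain \<gamma> :: "real \<Rightarrow> 'a" where \<gamma>: "\<gamma> 0 = x" "\<And>t. \<gamma> t \<in> sphere 0 r"
    "(\<gamma> has_vector_derivative v) (at 0)"
    unfolding tangent_space_def by blast
  have "((\<lambda>t. \<gamma> t \<bullet> \<gamma> t) has_vector_derivative (\<gamma> 0 \<bullet> v + v \<bullet> \<gamma> 0)) (at 0)"
    by (rule bounded_bilinear.has_vector_derivative[OF bounded_bilinear_inner \<gamma>(3) \<gamma>(3)])
  moreover have "(\<lambda>t. \<gamma> t \<bullet> \<gamma> t) = (\<lambda>t. r\<^sup>2)"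
    using \<gamma>(2) by (auto simp: dot_square_norm)
  ultimately have "((\<lambda>t::real. r\<^sup>2) has_vector_derivative (\<gamma> 0 \<bullet> v + v \<bullet> \<gamma> 0)) (at 0)"
    by simp
  then have "\<gamma> 0 \<bullet> v + v \<bullet> \<gamma> 0 = 0"
    using vector_derivative_unique_at has_vector_derivative_const by blast
  then show "v \<bullet> x = 0"
    using \<gamma>(1) by (simp add: inner_commute)
next
  fix v assume v: "v \<bullet> x = 0"
  \<comment> \<open>The tangent line at \<open>x\<close>, pushed radially onto the sphere.\<close>
  define \<gamma> where "\<gamma> t = (r / sqrt (r\<^sup>2 + t\<^sup>2 * (norm v)\<^sup>2)) *\<^sub>R (x + t *\<^sub>R v)" for t
  have pos: "r\<^sup>2 + t\<^sup>2 * (norm v)\<^sup>2 > 0" for t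
    using r by (simp add: add_pos_nonneg)
  have "norm (x + t *\<^sub>R v) = sqrt (r\<^sup>2 + t\<^sup>2 * (norm v)\<^sup>2)" for t
    using v x norm_add_Pythagorean[of x "t *\<^sub>R v"]
    by (intro real_sqrt_unique[symmetric]) (auto simp: orthogonal_def inner_commute power_mult_distrib)
  then have "\<gamma> t \<in> sphere 0 r" for t
    using r pos[of t] by (simp add: \<gamma>_def)
  moreover have "\<gamma> 0 = x"
    using r by (simp add: \<gamma>_def)
  moreover have "(\<gamma> has_vector_derivative v) (at 0)"
    unfolding \<gamma>_def has_vector_derivative_def using r
    by (auto intro!: derivative_eq_intros simp: fun_eq_iff)
  ultimately show "v \<in> tangent_space (sphere 0 r) x"
    unfolding tangent_space_def by blast
qed

lemma tangent_proj_sphere: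
  fixes x :: "'a::euclidean_space"
  assumes r: "r > 0" and x: "norm x = r"
  shows "tangent_proj (sphere 0 r) x v = v - (v \<bullet> x / r\<^sup>2) *\<^sub>R x"
proof -
  let ?T = "{v. v \<bullet> x = 0}" and ?w = "v - (v \<bullet> x / r\<^sup>2) *\<^sub>R x"
  have xx: "x \<bullet> x = r\<^sup>2" using x by (simp add: dot_square_norm)
  have T: "?T = {v. x \<bullet> v = 0}" by (auto simp: inner_commute)
  have w: "?w \<in> ?T" using r by (simp add: inner_simps xx)
  have "dist v ?w \<le> dist v z" if "z \<in> ?T" for z
  proof -
    have "(v - ?w) \<bullet> (?w - z) = 0" using that w by (simp add: inner_simps inner_commute)
    then have "(dist v z)\<^sup>2 = (dist v ?w)\<^sup>2 + (norm (?w - z))\<^sup>2"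
      using norm_add_Pythagorean[of "v - ?w" "?w - z"] by (simp add: orthogonal_def dist_norm)
    then show ?thesis by (smt (verit) zero_le_power2 power2_le_imp_le zero_le_dist)
  qed
  moreover have "convex ?T" "closed ?T"
    unfolding T by (simp_all add: convex_hyperplane closed_hyperplane)
  ultimately have "?w = closest_point ?T v"
    using w by (intro closest_point_unique) auto
  then show ?thesis
    by (simp add: tangent_proj_def tangent_space_sphere[OF r x])
qed

lemma ext_field_sphere:
  fixes x :: "'a::euclidean_space"
  assumes "r > 0" "norm x = r"
  shows "ext_field (sphere 0 r) v x = v - (v \<bullet> x / r\<^sup>2) *\<^sub>R x"
  using assms by (simp add: ext_field_def tangent_proj_sphere)

lemma ext_field_tangent:
  fixes x :: "'a::euclidean_space"
  assumes "r > 0" "norm x = r"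
  shows "ext_field (sphere 0 r) v x \<in> tangent_space (sphere 0 r) x"
  using assms by (simp add: ext_field_sphere tangent_space_sphere inner_simps dot_square_norm)

text \<open>The derivative of the tangential part of a constant field splits into a normal part and
  a multiple of the direction; for the Levi-Civita connection only the latter survives.\<close>
lemma deriv_along_ext_field:
  fixes x :: "'a::euclidean_space"
  assumes r: "r > 0" and x: "norm x = r" and u: "u \<bullet> x = 0"
  shows "deriv_along (sphere 0 r) (ext_field (sphere 0 r) v) x u
    = - ((v \<bullet> u / r\<^sup>2) *\<^sub>R x + (v \<bullet> x / r\<^sup>2) *\<^sub>R u)"
  by (rule deriv_along_eq_on[where g = "\<lambda>y. v - (v \<bullet> y / r\<^sup>2) *\<^sub>R y"])
    (auto intro!: derivative_eq_intros simp: r x u r[THEN less_imp_neq, symmetric] tangent_space_sphere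
      ext_field_sphere algebra_simps divide_simps fun_eq_iff)

lemma LC_conn_ext_field:
  fixes x :: "'a::euclidean_space"
  assumes r: "r > 0" and x: "norm x = r" and u: "u \<bullet> x = 0"
  shows "LC_conn (sphere 0 r) x u (ext_field (sphere 0 r) v) = - (v \<bullet> x / r\<^sup>2) *\<^sub>R u"
  using assms
  by (simp add: LC_conn_def pullback_conn_def deriv_along_ext_field tangent_proj_sphere
      inner_simps dot_square_norm)

text \<open>At \<open>p\<close> the extensions are chosen such that the Lie bracket vanishes and only the derivative
  of the coefficient in \<open>\<nabla>\<^sub>Y Z = - (w \<bullet> q) Y\<close> contributes.\<close>
lemma curvature_unit_sphere:
  fixes p :: "'a::euclidean_space"
  assumes p: "norm p = 1" and uvw: "u \<bullet> p = 0" "v \<bullet> p = 0" "w \<bullet> p = 0"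
  shows "curvature (sphere 0 1) p u v w = (v \<bullet> w) *\<^sub>R u - (u \<bullet> w) *\<^sub>R v"
proof -
  let ?S = "sphere 0 1 :: 'a set"
  have nested: "LC_conn ?S p u (\<lambda>q. LC_conn ?S q (ext_field ?S v q) (ext_field ?S w))
    = - (w \<bullet> u) *\<^sub>R v" if u: "u \<bullet> p = 0" and v: "v \<bullet> p = 0" for u v
  proof -
    let ?D = "\<lambda>u. - (w \<bullet> u) *\<^sub>R v + (w \<bullet> u) *\<^sub>R (v \<bullet> p) *\<^sub>R p
      + (w \<bullet> p) *\<^sub>R ((v \<bullet> u) *\<^sub>R p + (v \<bullet> p) *\<^sub>R u)"
    have "deriv_along ?S (\<lambda>q. LC_conn ?S q (ext_field ?S v q) (ext_field ?S w)) p u = ?D u"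
    proof (rule deriv_along_eq_on)
      show "((\<lambda>q. - (w \<bullet> q) *\<^sub>R (v - (v \<bullet> q) *\<^sub>R q)) has_derivative ?D) (at p within ?S)"
        by (auto intro!: derivative_eq_intros simp: algebra_simps fun_eq_iff)
      show "LC_conn ?S q (ext_field ?S v q) (ext_field ?S w)
        = - (w \<bullet> q) *\<^sub>R (v - (v \<bullet> q) *\<^sub>R q)" if "q \<in> ?S" for q
        using that ext_field_tangent[of 1 q v]
        by (simp add: LC_conn_ext_field tangent_space_sphere ext_field_sphere)
    qed (use p u v uvw in \<open>auto simp: tangent_space_sphere\<close>)
    then show ?thesis
      using p v uvw by (simp add: LC_conn_def pullback_conn_def tangent_proj_sphere)
  qed
  have ext: "ext_field ?S z p = z" if "z \<bullet> p = 0" for z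
    using that p by (simp add: ext_field_sphere)
  have "lie_bracket ?S (ext_field ?S u) (ext_field ?S v) p = 0"
    using uvw p by (simp add: lie_bracket_def ext deriv_along_ext_field inner_commute)
  then show ?thesis
    using uvw p
    by (simp add: curvature_def curvature_field_def ext nested LC_conn_ext_field inner_commute)
qed

section \<open>Traces\<close>

definition orthonormal :: "'a::euclidean_space set \<Rightarrow> bool" where
  "orthonormal E \<longleftrightarrow> pairwise orthogonal E \<and> (\<forall>e\<in>E. norm e = 1)"

lemma orthonormal_independent: "orthonormal E \<Longrightarrow> independent E"
  unfolding orthonormal_def by (intro pairwise_orthogonal_independent) auto

lemma orthonormal_finite: "orthonormal E \<Longrightarrow> finite E"
  using orthonormal_independent independent_imp_finite by blast

lemma orthonormal_expansion:
  fixes E :: "'a::euclidean_space set"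
  assumes E: "orthonormal E" and x: "x \<in> span E"
  shows "x = (\<Sum>e\<in>E. (x \<bullet> e) *\<^sub>R e)"
proof -
  have fin: "finite E" using E by (rule orthonormal_finite)
  obtain k where k: "x = (\<Sum>e\<in>E. k e *\<^sub>R e)"
    using x span_finite[OF fin] by auto
  have "x \<bullet> e = k e" if e: "e \<in> E" for e
  proof -
    have "x \<bullet> e = (\<Sum>d\<in>E. k d * (d \<bullet> e))" by (simp add: k inner_sum_left)
    also have "\<dots> = (\<Sum>d\<in>E. if d = e then k d else 0)"
      using E e by (intro sum.cong)
        (auto simp: orthonormal_def pairwise_def orthogonal_def dot_square_norm)
    also have "\<dots> = k e" using fin e by simp
    finally show ?thesis .
  qed
  then show ?thesis using k by simp
qed

text \<open>Expanding one orthonormal basis in another and applying Parseval's identity shows that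
  both give the same trace.\<close>
lemma trace_orthonormal_basis:
  fixes E :: "'a::euclidean_space set" and q :: "'a \<Rightarrow> 'a \<Rightarrow> 'b::euclidean_space"
  assumes q: "bilinear q" and E: "orthonormal E" "span E = UNIV"
  shows "(\<Sum>e\<in>E. q e e) = (\<Sum>b\<in>Basis. q b b)"
proof -
  have fin: "finite E" using E orthonormal_finite by blast
  have expand: "q e e = (\<Sum>b\<in>Basis. \<Sum>d\<in>Basis. ((e \<bullet> b) * (e \<bullet> d)) *\<^sub>R q b d)" for e
  proof -
    have "q e e = q (\<Sum>b\<in>Basis. (e \<bullet> b) *\<^sub>R b) (\<Sum>d\<in>Basis. (e \<bullet> d) *\<^sub>R d)"
      by (simp add: euclidean_representation)
    also have "\<dots> = (\<Sum>(b,d)\<in>Basis \<times> Basis. ((e \<bullet> b) * (e \<bullet> d)) *\<^sub>R q b d)"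
      by (subst bilinear_sum[OF q])
        (auto simp: bilinear_lmul[OF q] bilinear_rmul[OF q] intro!: sum.cong)
    finally show ?thesis by (simp add: sum.cartesian_product)
  qed
  have parseval: "(\<Sum>e\<in>E. (e \<bullet> b) * (e \<bullet> d)) = b \<bullet> d" for b d
  proof -
    have "b \<bullet> d = (\<Sum>e\<in>E. (b \<bullet> e) *\<^sub>R e) \<bullet> d"
      using orthonormal_expansion[OF E(1), of b] E(2) by simp
    then show ?thesis by (simp only: inner_sum_left inner_scaleR_left inner_commute[of b])
  qed
  have "(\<Sum>e\<in>E. q e e) = (\<Sum>b\<in>Basis. \<Sum>d\<in>Basis. (\<Sum>e\<in>E. (e \<bullet> b) * (e \<bullet> d)) *\<^sub>R q b d)"
    unfolding expand scaleR_left.sum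
    by (subst sum.swap, rule sum.cong[OF refl], subst sum.swap, rule refl)
  also have "\<dots> = (\<Sum>b\<in>Basis. \<Sum>d\<in>Basis. if d = b then q b d else 0)"
    unfolding parseval by (intro sum.cong refl) (auto simp: inner_Basis)
  also have "\<dots> = (\<Sum>b\<in>Basis. q b b)" by simp
  finally show ?thesis .
qed

text \<open>An orthonormal basis of the tangent space together with the unit normal is one of the ambient
  space; thus the tangential trace of a bilinear form is the full trace minus the normal term.
  The form \<open>q\<close> itself need only agree with a bilinear one on tangent vectors.\<close>
lemma trace_on_tangent_space:
  fixes x :: "'a::euclidean_space" and q :: "'a \<Rightarrow> 'a \<Rightarrow> 'b::euclidean_space"
  assumes r: "r > 0" and x: "norm x = r" and p: "bilinear p"
    and pq: "\<And>v. v \<bullet> x = 0 \<Longrightarrow> q v v = p v v"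
  shows "trace_on (tangent_space (sphere 0 r) x) q
    = (\<Sum>b\<in>Basis. p b b) - (1 / r\<^sup>2) *\<^sub>R p x x"
proof -
  let ?T = "{v. v \<bullet> x = 0}"
  define E where "E = (SOME E. pairwise orthogonal E \<and> (\<forall>e\<in>E. norm e = 1) \<and> span E = ?T)"
  have "subspace ?T"
    using subspace_hyperplane[of x] by (simp add: inner_commute)
  then obtain B where "B \<subseteq> ?T" "pairwise orthogonal B" "\<And>e. e \<in> B \<Longrightarrow> norm e = 1" "span B = ?T"
    using orthonormal_basis_subspace[of ?T] by metis
  then have "\<exists>E. pairwise orthogonal E \<and> (\<forall>e\<in>E. norm e = 1) \<and> span E = ?T" by blast
  then have "pairwise orthogonal E \<and> (\<forall>e\<in>E. norm e = 1) \<and> span E = ?T"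
    unfolding E_def by (rule someI_ex)
  then have E: "orthonormal E" "span E = ?T" by (auto simp: orthonormal_def)
  have perp: "e \<bullet> x = 0" if "e \<in> E" for e
    using that E(2) span_base by blast
  define n where "n = (1 / r) *\<^sub>R x"
  have n: "norm n = 1" "x = r *\<^sub>R n" using r x by (auto simp: n_def)
  have notin: "n \<notin> E"
    using perp n r by (metis inner_scaleR_right inner_eq_zero_iff mult_eq_0_iff
        norm_zero zero_neq_one less_irrefl)
  have on: "orthonormal (insert n E)"
    using E(1) n(1) perp unfolding orthonormal_def pairwise_insert
    by (auto simp: orthogonal_def n_def inner_commute)
  have "v \<in> span (insert n E)" for v
  proof -
    have "v - (v \<bullet> x / r\<^sup>2) *\<^sub>R x \<in> ?T"
      using x r by (simp add: inner_simps dot_square_norm)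
    then have "v - (v \<bullet> x / r\<^sup>2 * r) *\<^sub>R n \<in> span E"
      using E(2) n(2) by simp
    then show ?thesis using span_breakdown_eq by blast
  qed
  then have "(\<Sum>e\<in>insert n E. p e e) = (\<Sum>b\<in>Basis. p b b)"
    by (intro trace_orthonormal_basis[OF p on]) auto
  moreover have "p n n = (1 / r\<^sup>2) *\<^sub>R p x x"
    by (simp add: n_def bilinear_lmul[OF p] bilinear_rmul[OF p] power2_eq_square)
  ultimately have "(\<Sum>e\<in>E. p e e) = (\<Sum>b\<in>Basis. p b b) - (1 / r\<^sup>2) *\<^sub>R p x x"
    using notin orthonormal_finite[OF E(1)] by (simp add: algebra_simps)
  moreover have "trace_on ?T q = (\<Sum>e\<in>E. p e e)"
    using pq perp by (simp add: trace_on_def flip: E_def)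
  ultimately show ?thesis by (simp add: tangent_space_sphere[OF r x])
qed

section \<open>Quadratic forms between spheres and their polarised identities\<close>

locale sphere_form = bounded_bilinear G
  for G :: "'a::euclidean_space \<Rightarrow> 'a \<Rightarrow> 'b::euclidean_space" +
  fixes r :: real
  assumes sym: "G x y = G y x"
    and r_pos: "r > 0"
    and norm_G: "norm (G x x) = (norm x)\<^sup>2 / r\<^sup>2"
begin

lemmas G_simps = add_left add_right diff_left diff_right minus_left minus_right
  scaleR_left scaleR_right

text \<open>The \<open>t\<^sup>2\<close> coefficient of \<open>\<bar>F (x + t y)\<bar>\<^sup>2 = \<bar>x + t y\<bar>\<^sup>4 / r\<^sup>4\<close>, read off
  from \<open>t = 1\<close> and \<open>t = -1\<close>.\<close>
lemma polar_22:
  "2 * (G x y \<bullet> G x y) + G x x \<bullet> G y y = ((x \<bullet> x) * (y \<bullet> y) + 2 * (x \<bullet> y)\<^sup>2) / r^4"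
proof -
  define k where "k = 1 / r^4"
  have Q: "G z z \<bullet> G z z = (z \<bullet> z)\<^sup>2 * k" for z
    using norm_G[of z]
    by (simp add: k_def dot_square_norm power_divide flip: power_mult)
  have "2 * (G x y \<bullet> G x y) + G x x \<bullet> G y y = ((x \<bullet> x) * (y \<bullet> y) + 2 * (x \<bullet> y)\<^sup>2) * k"
    using Q[of "x + y"] Q[of "x - y"] Q[of x] Q[of y]
    by (simp add: G_simps inner_simps inner_commute[of y x] sym[of y x]
        inner_commute 
        power2_eq_square algebra_simps)
  then show ?thesis by (simp add: k_def)
qed

lemma polar_211:
  "G x x \<bullet> G y z + 2 * (G x y \<bullet> G x z) = ((x \<bullet> x) * (y \<bullet> z) + 2 * (x \<bullet> y) * (x \<bullet> z)) / r^4"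
  using polar_22[of x "y + z"] polar_22[of x y] polar_22[of x z]
  unfolding divide_inverse
  by (simp add: G_simps inner_simps inner_commute[of z y] sym[of z y]
      inner_commute[of "G x z" "G x y"] power2_eq_square algebra_simps)

lemma polar_1111:
  "G a b \<bullet> G c d + G a c \<bullet> G b d + G a d \<bullet> G b c
    = ((a \<bullet> b) * (c \<bullet> d) + (a \<bullet> c) * (b \<bullet> d) + (a \<bullet> d) * (b \<bullet> c)) / r^4"
  using polar_211[of "a + b" c d] polar_211[of a c d] polar_211[of b c d]
  unfolding divide_inverse
  by (simp add: G_simps inner_simps inner_commute[of b a] sym[of b a]
      inner_commute algebra_simps)

lemma polar_31: "G x x \<bullet> G x y = (x \<bullet> x) * (x \<bullet> y) / r^4"
  using polar_211[of x x y] by (simp add: add_divide_distrib)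

lemma norm_on_sphere: "norm x = r \<Longrightarrow> norm (G x x) = 1"
  using norm_G r_pos by simp

lemma normal_part_zero: "v \<bullet> x = 0 \<Longrightarrow> G x v \<bullet> G x x = 0"
  using polar_31[of x v] by (simp add: inner_commute)

lemma bilinear_G: "bilinear G"
  by (simp add: bilinear_conv_bounded_bilinear bounded_bilinear_axioms)

text \<open>The Laplacian of the homogeneous polynomial map \<open>x \<mapsto> G x x\<close> on the ambient Euclidean space.\<close>
definition flat_laplacian :: 'b where
  "flat_laplacian = 2 *\<^sub>R (\<Sum>b\<in>Basis. G b b)"

abbreviation "c \<equiv> flat_laplacian"

lemma sum_G: "(\<Sum>b\<in>Basis. G b b) = (1 / 2) *\<^sub>R c"
  by (simp add: flat_laplacian_def)

text \<open>This is \<open>1/4\<close> of \<open>dF\<close> applied to the spherical gradient of \<open>c \<bullet> F\<close>; the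
  subtracted term removes the radial direction from the sum over a basis of the ambient space.\<close>
definition gradient_term :: "'a \<Rightarrow> 'b" where
  "gradient_term x = (\<Sum>b\<in>Basis. (c \<bullet> G x b) *\<^sub>R G x b) - ((c \<bullet> G x x) / r\<^sup>2) *\<^sub>R G x x"

end

section \<open>The tension field of a quadratic form\<close>

locale sphere_form_map = sphere_form G r
  for G :: "'a::euclidean_space \<Rightarrow> 'a \<Rightarrow> 'b::euclidean_space" and r +
  fixes \<phi> :: "'a \<Rightarrow> 'b"
  assumes \<phi>_eq: "norm x = r \<Longrightarrow> \<phi> x = G x x"
begin

lemma deriv_along_form:
  assumes x: "norm x = r" and v: "v \<bullet> x = 0"
  shows "deriv_along (sphere 0 r) \<phi> x v = 2 *\<^sub>R G x v"
proof -
  have "deriv_along (sphere 0 r) \<phi> x v = (\<lambda>v. G x v + G v x) v"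
    using x v r_pos
    by (intro deriv_along_eq_on[where g = "\<lambda>y. G y y"] FDERIV has_derivative_ident)
      (auto simp: tangent_space_sphere \<phi>_eq)
  then show ?thesis by (simp add: sym[of v x] scaleR_2)
qed

lemma second_fundamental_form_form:
  assumes x: "norm x = r" and u: "u \<bullet> x = 0" and v: "v \<bullet> x = 0"
  shows "second_fundamental_form (sphere 0 r) (sphere 0 1) \<phi> x u v
    = 2 *\<^sub>R (G u v - (G u v \<bullet> G x x) *\<^sub>R G x x)"
proof -
  let ?S = "sphere 0 r"
  define k where "k = 1 / r\<^sup>2"
  let ?D = "\<lambda>u. 2 *\<^sub>R G u v - (2 * k * (v \<bullet> u)) *\<^sub>R G x x
    - (2 * k * (v \<bullet> x)) *\<^sub>R (G x u + G u x)"
  have D: "deriv_along ?S (\<lambda>y. deriv_along ?S \<phi> y (ext_field ?S v y)) x u = ?D u"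
  proof (rule deriv_along_eq_on)
    show "((\<lambda>y. 2 *\<^sub>R G y v - (2 * k * (v \<bullet> y)) *\<^sub>R G y y) has_derivative ?D) (at x within ?S)"
      by (auto intro!: derivative_eq_intros FDERIV has_derivative_ident
          simp: zero_left zero_right algebra_simps fun_eq_iff)
    show "deriv_along ?S \<phi> y (ext_field ?S v y)
      = 2 *\<^sub>R G y v - (2 * k * (v \<bullet> y)) *\<^sub>R G y y" if "y \<in> ?S" for y
      using that ext_field_tangent[of r y v] r_pos
      by (simp add: deriv_along_form tangent_space_sphere ext_field_sphere G_simps k_def algebra_simps)
  qed (use x u r_pos in \<open>auto simp: tangent_space_sphere\<close>)
  have "deriv_along ?S \<phi> x (LC_conn ?S x u (ext_field ?S v)) = 0"
    using x u v r_pos by (simp add: LC_conn_ext_field deriv_along_form zero_right)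
  then show ?thesis
    using x v norm_on_sphere[OF x]
    by (simp add: second_fundamental_form_def D pullback_conn_def tangent_proj_sphere \<phi>_eq
        inner_simps dot_square_norm algebra_simps)
qed

lemma tension_form:
  assumes x: "norm x = r"
  shows "tension (sphere 0 r) (sphere 0 1) \<phi> x = c - (c \<bullet> G x x) *\<^sub>R G x x"
proof -
  let ?p = "\<lambda>u v. 2 *\<^sub>R (G u v - (G u v \<bullet> G x x) *\<^sub>R G x x)"
  have bil: "bilinear ?p"
    unfolding bilinear_def by (auto intro!: linearI simp: G_simps inner_simps algebra_simps)
  have "tension (sphere 0 r) (sphere 0 1) \<phi> x = (\<Sum>b\<in>Basis. ?p b b) - (1 / r\<^sup>2) *\<^sub>R ?p x x"
    unfolding tension_def
    by (rule trace_on_tangent_space[OF r_pos x bil]) (simp add: second_fundamental_form_form x)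
  also have "?p x x = 0"
    using norm_on_sphere[OF x] by (simp add: dot_square_norm)
  also have "(\<Sum>b\<in>Basis. ?p b b) = c - (c \<bullet> G x x) *\<^sub>R G x x"
    by (simp add: sum_subtractf sum_G
        flip: scaleR_sum_left scaleR_sum_right inner_sum_left) (simp add: algebra_simps)
  finally show ?thesis by simp
qed

section \<open>The bitension field of a quadratic form\<close>

text \<open>Along the map the tension field is \<open>c - (c \<bullet> F) F\<close>. Differentiating the factor
  \<open>c \<bullet> F\<close> gives a normal vector, so only the derivative of \<open>F\<close> survives the projection.\<close>
lemma pullback_conn_tension:
  assumes x: "norm x = r" and v: "v \<bullet> x = 0"
  shows "pullback_conn (sphere 0 r) (sphere 0 1) \<phi> x v (tension (sphere 0 r) (sphere 0 1) \<phi>)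
    = - (2 * (c \<bullet> G x x)) *\<^sub>R G x v"
proof -
  let ?S = "sphere 0 r"
  let ?D = "\<lambda>v. - ((c \<bullet> (G x v + G v x)) *\<^sub>R G x x) - (c \<bullet> G x x) *\<^sub>R (G x v + G v x)"
  have D: "deriv_along ?S (tension ?S (sphere 0 1) \<phi>) x v = ?D v"
  proof (rule deriv_along_eq_on)
    show "((\<lambda>y. c - (c \<bullet> G y y) *\<^sub>R G y y) has_derivative ?D) (at x within ?S)"
      by (auto intro!: derivative_eq_intros FDERIV has_derivative_ident
          simp: algebra_simps fun_eq_iff)
  qed (use x v r_pos in \<open>auto simp: tangent_space_sphere tension_form\<close>)
  show ?thesis
    using x v norm_on_sphere[OF x] normal_part_zero[OF v]
    by (simp add: D pullback_conn_def tangent_proj_sphere \<phi>_eq sym[of v x] inner_simps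
        dot_square_norm algebra_simps flip: scaleR_2)
qed

lemma second_covariant_deriv_tension:
  assumes x: "norm x = r" and u: "u \<bullet> x = 0" and v: "v \<bullet> x = 0"
  shows "second_covariant_deriv (sphere 0 r) (sphere 0 1) \<phi>
      (tension (sphere 0 r) (sphere 0 1) \<phi>) x u v
    = - 4 *\<^sub>R ((c \<bullet> G x u) *\<^sub>R G x v)
      - (2 * (c \<bullet> G x x)) *\<^sub>R (G u v - (G u v \<bullet> G x x) *\<^sub>R G x x)"
proof -
  let ?S = "sphere 0 r" and ?\<tau> = "tension (sphere 0 r) (sphere 0 1) \<phi>"
  define k where "k = 1 / r\<^sup>2"
  let ?D = "\<lambda>u. - (2 * (c \<bullet> (G x u + G u x))) *\<^sub>R (G x v - (k * (v \<bullet> x)) *\<^sub>R G x x)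
    - (2 * (c \<bullet> G x x)) *\<^sub>R (G u v - (k * (v \<bullet> u)) *\<^sub>R G x x
        - (k * (v \<bullet> x)) *\<^sub>R (G x u + G u x))"
  have "deriv_along ?S (\<lambda>y. pullback_conn ?S (sphere 0 1) \<phi> y (ext_field ?S v y) ?\<tau>) x u = ?D u"
  proof (rule deriv_along_eq_on)
    show "((\<lambda>y. - (2 * (c \<bullet> G y y)) *\<^sub>R (G y v - (k * (v \<bullet> y)) *\<^sub>R G y y)) has_derivative ?D)
      (at x within ?S)"
      by (auto intro!: derivative_eq_intros FDERIV has_derivative_ident
          simp: zero_left zero_right algebra_simps fun_eq_iff)
    show "pullback_conn ?S (sphere 0 1) \<phi> y (ext_field ?S v y) ?\<tau>
      = - (2 * (c \<bullet> G y y)) *\<^sub>R (G y v - (k * (v \<bullet> y)) *\<^sub>R G y y)" if "y \<in> ?S" for y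
      using that ext_field_tangent[of r y v] r_pos
      by (simp add: pullback_conn_tension tangent_space_sphere ext_field_sphere G_simps k_def)
  qed (use x u r_pos in \<open>auto simp: tangent_space_sphere\<close>)
  then have "pullback_conn ?S (sphere 0 1) \<phi> x u
      (\<lambda>y. pullback_conn ?S (sphere 0 1) \<phi> y (ext_field ?S v y) ?\<tau>)
    = tangent_proj (sphere 0 1) (\<phi> x) (?D u)"
    by (subst pullback_conn_def) (rule arg_cong)
  moreover have "pullback_conn ?S (sphere 0 1) \<phi> x (LC_conn ?S x u (ext_field ?S v)) ?\<tau> = 0"
    using x u v r_pos by (simp add: LC_conn_ext_field pullback_conn_tension zero_right)
  ultimately show ?thesis
    using x v norm_on_sphere[OF x] normal_part_zero[OF v]
    by (simp add: second_covariant_deriv_def tangent_proj_sphere \<phi>_eq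
        sym[of u x] inner_simps dot_square_norm algebra_simps flip: scaleR_2)
qed

lemma rough_laplacian_tension:
  assumes x: "norm x = r"
  shows "rough_laplacian (sphere 0 r) (sphere 0 1) \<phi> (tension (sphere 0 r) (sphere 0 1) \<phi>) x
    = 4 *\<^sub>R gradient_term x + (c \<bullet> G x x) *\<^sub>R (c - (c \<bullet> G x x) *\<^sub>R G x x)"
proof -
  let ?p = "\<lambda>u v. - 4 *\<^sub>R ((c \<bullet> G x u) *\<^sub>R G x v)
      - (2 * (c \<bullet> G x x)) *\<^sub>R (G u v - (G u v \<bullet> G x x) *\<^sub>R G x x)"
  have bil: "bilinear ?p"
    unfolding bilinear_def by (auto intro!: linearI simp: G_simps inner_simps algebra_simps)
  have "trace_on (tangent_space (sphere 0 r) x)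
    (second_covariant_deriv (sphere 0 r) (sphere 0 1) \<phi> (tension (sphere 0 r) (sphere 0 1) \<phi>) x)
    = (\<Sum>b\<in>Basis. ?p b b) - (1 / r\<^sup>2) *\<^sub>R ?p x x"
    by (rule trace_on_tangent_space[OF r_pos x bil]) (simp add: second_covariant_deriv_tension x)
  also have "?p x x = - (4 * (c \<bullet> G x x)) *\<^sub>R G x x"
    using norm_on_sphere[OF x] by (simp add: dot_square_norm)
  also have "(\<Sum>b\<in>Basis. ?p b b) = - 4 *\<^sub>R (\<Sum>b\<in>Basis. (c \<bullet> G x b) *\<^sub>R G x b)
    - (c \<bullet> G x x) *\<^sub>R (c - (c \<bullet> G x x) *\<^sub>R G x x)"
    by (simp add: sum_subtractf sum_negf sum_G flip: scaleR_sum_left scaleR_sum_right inner_sum_left)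
      (simp add: inner_commute algebra_simps scaleR_sum_right)
  finally show ?thesis
    by (simp add: rough_laplacian_def gradient_term_def algebra_simps)
qed

text \<open>The energy density, obtained by tracing the polarised norm identity: the Laplacian of the
  constant \<open>\<bar>\<phi>\<bar>\<^sup>2\<close> vanishes.\<close>
lemma energy_density:
  assumes x: "norm x = r"
  shows "4 * ((\<Sum>b\<in>Basis. G x b \<bullet> G x b) - (1 / r\<^sup>2) * (G x x \<bullet> G x x))
    = 2 * real DIM('a) / r\<^sup>2 - c \<bullet> G x x"
proof -
  have "(\<Sum>b\<in>Basis. 2 * (G x b \<bullet> G x b) + G x x \<bullet> G b b)
    = (\<Sum>b\<in>Basis. ((x \<bullet> x) * (b \<bullet> b) + 2 * (x \<bullet> b)\<^sup>2) / r^4)"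
    by (intro sum.cong refl polar_22)
  also have "\<dots> = (real DIM('a) * (x \<bullet> x) + 2 * (\<Sum>b\<in>Basis. (x \<bullet> b)\<^sup>2)) / r^4"
    by (simp add: sum_divide_distrib[symmetric] sum.distrib sum_distrib_left)
  also have "(\<Sum>b\<in>Basis. (x \<bullet> b)\<^sup>2) = x \<bullet> x"
    by (subst euclidean_inner) (simp add: power2_eq_square)
  also have "x \<bullet> x = r\<^sup>2"
    using x by (simp add: dot_square_norm)
  also have "(real DIM('a) * r\<^sup>2 + 2 * r\<^sup>2) / r^4 = (real DIM('a) + 2) / r\<^sup>2"
    using r_pos by (simp add: divide_simps power2_eq_square power4_eq_xxxx algebra_simps)
  finally have "2 * (\<Sum>b\<in>Basis. G x b \<bullet> G x b) + G x x \<bullet> (\<Sum>b\<in>Basis. G b b)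
    = (real DIM('a) + 2) / r\<^sup>2"
    by (simp add: sum.distrib inner_sum_right flip: sum_distrib_left)
  then show ?thesis
    using norm_on_sphere[OF x]
    unfolding divide_inverse
    by (simp add: sum_G dot_square_norm inner_commute algebra_simps)
qed

lemma trace_curvature:
  assumes x: "norm x = r"
  defines "\<tau> \<equiv> c - (c \<bullet> G x x) *\<^sub>R G x x"
  shows "trace_on (tangent_space (sphere 0 r) x)
      (\<lambda>u v. curvature (sphere 0 1) (\<phi> x) (deriv_along (sphere 0 r) \<phi> x u)
        (tension (sphere 0 r) (sphere 0 1) \<phi> x) (deriv_along (sphere 0 r) \<phi> x v))
    = 4 *\<^sub>R gradient_term x - (2 * real DIM('a) / r\<^sup>2 - c \<bullet> G x x) *\<^sub>R \<tau>"
proof -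
  let ?q = "\<lambda>u v. curvature (sphere 0 1) (\<phi> x) (deriv_along (sphere 0 r) \<phi> x u)
    (tension (sphere 0 r) (sphere 0 1) \<phi> x) (deriv_along (sphere 0 r) \<phi> x v)"
  let ?p = "\<lambda>u v. 4 *\<^sub>R ((c \<bullet> G x v) *\<^sub>R G x u) - (4 * (G x u \<bullet> G x v)) *\<^sub>R \<tau>"
  have n: "norm (\<phi> x) = 1" using x by (simp add: \<phi>_eq norm_on_sphere)
  have bil: "bilinear ?p"
    unfolding bilinear_def by (auto intro!: linearI simp: G_simps inner_simps algebra_simps)
  have "?q v v = ?p v v" if v: "v \<bullet> x = 0" for v
    using n x v norm_on_sphere[OF x] normal_part_zero[OF v]
    by (subst curvature_unit_sphere)
      (auto simp: deriv_along_form tension_form \<tau>_def \<phi>_eq inner_simps dot_square_norm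
        inner_commute)
  then have "trace_on (tangent_space (sphere 0 r) x) ?q
    = (\<Sum>b\<in>Basis. ?p b b) - (1 / r\<^sup>2) *\<^sub>R ?p x x"
    by (rule trace_on_tangent_space[OF r_pos x bil])
  also have "\<dots> = 4 *\<^sub>R gradient_term x
    - (4 * ((\<Sum>b\<in>Basis. G x b \<bullet> G x b) - (1 / r\<^sup>2) * (G x x \<bullet> G x x))) *\<^sub>R \<tau>"
    by (simp add: gradient_term_def sum_subtractf
        flip: scaleR_sum_left scaleR_sum_right sum_distrib_left)
      (simp add: algebra_simps scaleR_sum_right)
  finally show ?thesis using energy_density[OF x] by simp
qed

lemma bitension_form:
  assumes x: "norm x = r"
  shows "bitension (sphere 0 r) (sphere 0 1) \<phi> x
    = 2 *\<^sub>R ((real DIM('a) / r\<^sup>2 - c \<bullet> G x x) *\<^sub>R (c - (c \<bullet> G x x) *\<^sub>R G x x)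
        - 4 *\<^sub>R gradient_term x)"
  unfolding bitension_def trace_curvature[OF x] rough_laplacian_tension[OF x]
  by (simp add: algebra_simps flip: scaleR_2)

end

section \<open>Smoothness and homothetic transformations\<close>

lemma Ck_on_const: "Ck_on k UNIV (\<lambda>x. a)"
  by (induction k arbitrary: a) auto

lemma Ck_on_bounded_linear:
  assumes "bounded_linear f"
  shows "Ck_on k UNIV f"
proof (cases k)
  case 0
  then show ?thesis using assms by (simp add: linear_continuous_on)
next
  case (Suc j)
  have "frechet_derivative f (at x) = f" for x
    using bounded_linear_imp_has_derivative[OF assms] by (metis frechet_derivative_at)
  then show ?thesis
    using Suc Ck_on_const bounded_linear_imp_differentiable[OF assms] by auto
qed

lemma Ck_on_quadratic:
  assumes G: "bounded_bilinear G"
  shows "Ck_on k UNIV (\<lambda>x. G x x)"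
proof -
  interpret bounded_bilinear G by fact
  have D: "((\<lambda>x. G x x) has_derivative (\<lambda>v. G x v + G v x)) (at x)" for x
    by (intro FDERIV has_derivative_ident)
  show ?thesis
  proof (cases k)
    case 0
    then show ?thesis
      using D by (auto intro!: has_derivative_continuous_on)
  next
    case (Suc j)
    have "frechet_derivative (\<lambda>x. G x x) (at x) v = G x v + G v x" for x v
      using frechet_derivative_at[OF D] by metis
    moreover have "Ck_on j UNIV (\<lambda>x. G x v + G v x)" for v
      by (intro Ck_on_bounded_linear bounded_linear_add bounded_linear_left bounded_linear_right)
    moreover have "(\<lambda>x. G x x) differentiable (at x)" for x
      using D by (rule differentiableI)
    ultimately show ?thesis
      using Suc by simp
  qed
qed

lemma smooth_mapI:
  assumes "\<And>x. x \<in> M \<Longrightarrow> \<phi> x \<in> N" "\<And>k. Ck_on k UNIV g" "\<And>x. x \<in> M \<Longrightarrow> \<phi> x = g x"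
  shows "smooth_map M N \<phi>"
  unfolding smooth_map_def using assms by (metis IntD1 UNIV_I image_subsetI open_UNIV)

text \<open>Only conformality of a linear map has to be checked: it implies injectivity, and equal
  dimensions supply the inverse.\<close>
lemma homothetic_transformation_linear:
  fixes f :: "'a::euclidean_space \<Rightarrow> 'b::euclidean_space"
  assumes lin: "linear f" and f: "\<And>x y. f x \<bullet> f y = k * (x \<bullet> y)" and k: "k > 0"
    and dim: "DIM('a) = DIM('b)" and r: "r > 0"
  shows "homothetic_transformation (sphere 0 r) (sphere 0 (sqrt k * r)) f"
proof -
  have norm_f: "norm (f x) = sqrt k * norm x" for x
    by (simp add: norm_eq_sqrt_inner f real_sqrt_mult)
  have inj: "inj f"
    unfolding linear_injective_0[OF lin]
  proof (intro allI impI)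
    show "x = 0" if "f x = 0" for x
      using that norm_f[of x] k by simp
  qed
  have "dim (range f) = DIM('a)"
    using dim_image_eq[OF lin] inj by simp
  then have "span (range f) = UNIV"
    using dim_eq_full[of "range f"] dim by simp
  then have surj: "range f = UNIV"
    by (simp add: lin linear_subspace_image span_eq_iff[THEN iffD2])
  define g where "g = inv f"
  have gf: "g (f x) = x" and fg: "f (g y) = y" for x y
    using inj surj by (simp_all add: g_def surj_f_inv_f)
  have "linear g"
  proof (rule linearI)
    show "g (y + z) = g y + g z" for y z
      using gf[of "g y + g z"] by (simp add: linear_add[OF lin] fg)
    show "g (a *\<^sub>R y) = a *\<^sub>R g y" for a y
      using gf[of "a *\<^sub>R g y"] by (simp add: linear_cmul[OF lin] fg)
  qed
  moreover have norm_g: "norm (g y) = norm y / sqrt k" for y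
    using norm_f[of "g y"] k by (simp add: fg field_simps)
  ultimately have "smooth_map (sphere 0 (sqrt k * r)) (sphere 0 r) g"
    using k by (intro smooth_mapI[where g = g] Ck_on_bounded_linear) (auto simp: linear_conv_bounded_linear)
  moreover have "smooth_map (sphere 0 r) (sphere 0 (sqrt k * r)) f"
    using lin by (intro smooth_mapI[where g = f] Ck_on_bounded_linear)
      (auto simp: linear_conv_bounded_linear norm_f)
  moreover have "deriv_along (sphere 0 r) f x u = f u"
    if "u \<in> tangent_space (sphere 0 r) x" for x u
    using lin that by (intro deriv_along_eq bounded_linear_imp_has_derivative)
      (auto simp: linear_conv_bounded_linear)
  ultimately show ?thesis
    unfolding homothetic_transformation_def using k f gf fg by auto
qed

section \<open>The Hopf fibration followed by the inclusion is proper biharmonic\<close>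

lemma homogeneous_quadratic_form:
  assumes "bilinear G"
  shows "homogeneous_quadratic (\<lambda>x. G x x \<bullet> b)"
proof -
  have "G x x \<bullet> b = (\<Sum>i\<in>Basis. \<Sum>j\<in>Basis. (G i j \<bullet> b) * (x \<bullet> i) * (x \<bullet> j))" for x
  proof -
    have "G x x = G (\<Sum>i\<in>Basis. (x \<bullet> i) *\<^sub>R i) (\<Sum>j\<in>Basis. (x \<bullet> j) *\<^sub>R j)"
      by (simp add: euclidean_representation)
    also have "\<dots> = (\<Sum>(i,j)\<in>Basis \<times> Basis. ((x \<bullet> i) * (x \<bullet> j)) *\<^sub>R G i j)"
      by (subst bilinear_sum[OF assms])
        (auto simp: bilinear_lmul[OF assms] bilinear_rmul[OF assms] intro!: sum.cong)
    finally have "G x x = (\<Sum>i\<in>Basis. \<Sum>j\<in>Basis. ((x \<bullet> i) * (x \<bullet> j)) *\<^sub>R G i j)"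
      by (simp add: sum.cartesian_product)
    then show ?thesis by (simp add: inner_sum_left mult_ac)
  qed
  then show ?thesis unfolding homogeneous_quadratic_def by (intro exI allI)
qed

context sphere_form_map
begin

lemma smooth_form: "smooth_map (sphere 0 r) (sphere 0 1) \<phi>"
  by (rule smooth_mapI[where g = "\<lambda>x. G x x"])
    (auto simp: \<phi>_eq norm_on_sphere Ck_on_quadratic bounded_bilinear_axioms)

text \<open>If \<open>c \<bullet> F\<close> is the constant \<open>n / r\<^sup>2\<close> on the sphere, both terms of the bitension field
  vanish.\<close>
lemma biharmonic_if_laplacian_radial:
  assumes c: "\<And>x y. c \<bullet> G x y = (real DIM('a) / r^4) * (x \<bullet> y)"
  shows "biharmonic_map (sphere 0 r) (sphere 0 1) \<phi>"
proof -
  have "bitension (sphere 0 r) (sphere 0 1) \<phi> x = 0" if x: "norm x = r" for x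
  proof -
    have "(\<Sum>b\<in>Basis. (c \<bullet> G x b) *\<^sub>R G x b) = (real DIM('a) / r^4) *\<^sub>R G x (\<Sum>b\<in>Basis. (x \<bullet> b) *\<^sub>R b)"
      by (simp add: c sum_right scaleR_right scaleR_sum_right)
    then have "(\<Sum>b\<in>Basis. (c \<bullet> G x b) *\<^sub>R G x b) = (real DIM('a) / r^4) *\<^sub>R G x x"
      by (simp add: euclidean_representation)
    moreover have "c \<bullet> G x x = real DIM('a) / r\<^sup>2"
      using x r_pos by (simp add: c dot_square_norm power4_eq_xxxx power2_eq_square)
    ultimately show ?thesis
      by (simp add: bitension_form[OF x] gradient_term_def power4_eq_xxxx power2_eq_square)
  qed
  then show ?thesis by (simp add: biharmonic_map_def smooth_form)
qed

end

text \<open>The polarisation of \<open>hopf_incl\<close>.\<close>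
definition hopf_form :: "complex \<times> complex \<Rightarrow> complex \<times> complex \<Rightarrow> complex \<times> real \<times> real" where
  "hopf_form p q = (1 / (2 * sqrt 2)) *\<^sub>R
     (fst p * cnj (snd q) + fst q * cnj (snd p), fst p \<bullet> fst q - snd p \<bullet> snd q, p \<bullet> q)"

lemma hopf_incl_eq: "hopf_incl p = hopf_form p p"
  by (cases p) (simp add: hopf_incl_def hopf_form_def power2_norm_eq_inner)

lemma bilinear_hopf_form: "bilinear hopf_form"
  unfolding bilinear_def hopf_form_def
  by (auto intro!: linearI simp: prod_eq_iff complex_eq_iff inner_complex_def inner_prod_def
      field_simps)

lemma norm_hopf_form: "norm (hopf_form p p) = (norm p)\<^sup>2 / 2"
proof -
  obtain a b where p: "p = (a, b)" by (cases p)
  have "(norm (hopf_form p p))\<^sup>2 = ((norm p)\<^sup>2 / 2)\<^sup>2"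
    unfolding power2_norm_eq_inner p hopf_form_def
    by (simp add: inner_complex_def power2_eq_square field_simps)
  then show ?thesis by (simp add: power2_eq_iff_nonneg)
qed

interpretation hopf: sphere_form_map hopf_form "sqrt 2" hopf_incl
proof unfold_locales
  interpret bounded_bilinear hopf_form
    using bilinear_hopf_form by (simp add: bilinear_conv_bounded_bilinear)
  show "hopf_form (a + a') b = hopf_form a b + hopf_form a' b"
    "hopf_form a (b + b') = hopf_form a b + hopf_form a b'"
    "hopf_form (r *\<^sub>R a) b = r *\<^sub>R hopf_form a b"
    "hopf_form a (r *\<^sub>R b) = r *\<^sub>R hopf_form a b" for a a' b b' r
    by (simp_all add: add_left add_right scaleR_left scaleR_right)
  show "\<exists>K. \<forall>a b. norm (hopf_form a b) \<le> norm a * norm b * K" by (rule bounded)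
  show "hopf_form x y = hopf_form y x" for x y
    by (simp add: hopf_form_def inner_commute add.commute)
qed (simp_all add: norm_hopf_form hopf_incl_eq)

lemma hopf_laplacian: "hopf.flat_laplacian = (0, 0, 2 * sqrt 2)"
proof -
  have B: "(Basis :: (complex \<times> complex) set) = {(1, 0), (\<i>, 0), (0, 1), (0, \<i>)}"
    by (auto simp: Basis_prod_def Basis_complex_def)
  show ?thesis
    unfolding hopf.flat_laplacian_def B
    by (simp add: hopf_form_def zero_prod_def field_simps)
qed

lemma proper_biharmonic_hopf_incl:
  "proper_biharmonic (sphere 0 (sqrt 2)) (sphere 0 1) hopf_incl"
proof -
  have "hopf.flat_laplacian \<bullet> hopf_form x y = x \<bullet> y" for x y
    by (simp add: hopf_laplacian hopf_form_def)
  then have "biharmonic_map (sphere 0 (sqrt 2)) (sphere 0 1) hopf_incl"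
    by (intro hopf.biharmonic_if_laplacian_radial) (simp add: power4_eq_xxxx)
  moreover
  let ?p = "(complex_of_real (sqrt 2), 0) :: complex \<times> complex"
  have "tension (sphere 0 (sqrt 2)) (sphere 0 1) hopf_incl ?p \<noteq> 0"
    by (subst hopf.tension_form) (auto simp: hopf_laplacian hopf_form_def zero_prod_def)
  then have "\<not> harmonic_map (sphere 0 (sqrt 2)) (sphere 0 1) hopf_incl"
    by (auto simp: harmonic_map_def dest!: bspec[where x = ?p])
  ultimately show ?thesis by (simp add: proper_biharmonic_def)
qed

lemma quadratic_form_hopf_incl:
  "quadratic_form_between_spheres (\<lambda>x. hopf_incl (sqrt 2 *\<^sub>R x))"
proof -
  let ?F = "\<lambda>x. hopf_incl (sqrt 2 *\<^sub>R x)"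
  have F: "?F x = 2 *\<^sub>R hopf_form x x" for x
    by (simp add: hopf_incl_eq hopf.scaleR_left hopf.scaleR_right)
  have "bilinear (\<lambda>x y. 2 *\<^sub>R hopf_form x y)"
    unfolding bilinear_def
    by (intro conjI allI linearI) (simp_all add: hopf.G_simps algebra_simps)
  then have "homogeneous_quadratic (\<lambda>x. ?F x \<bullet> b)" for b
    unfolding F by (rule homogeneous_quadratic_form)
  moreover have "?F ` sphere 0 1 \<subseteq> sphere 0 1"
    by (auto simp: F norm_hopf_form)
  moreover have "\<not> ?F constant_on sphere 0 1"
  proof
    assume "?F constant_on sphere 0 1"
    then obtain w where w: "\<forall>x\<in>sphere 0 1. ?F x = w"
      unfolding constant_on_def by blast
    have ne: "?F (1, 0) \<noteq> ?F (0, 1)"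
      unfolding F by (simp add: hopf_form_def)
    have "?F (1, 0) = w" "?F (0, 1) = w"
      by (rule bspec[OF w]; simp)+
    then have "?F (1, 0) = ?F (0, 1)" by (rule trans[OF _ HOL.sym])
    with ne show False by (rule notE)
  qed
  ultimately show ?thesis
    unfolding quadratic_form_between_spheres_def by (intro conjI exI[of _ ?F] ballI refl)
qed

section \<open>The component in the direction of the Laplacian\<close>

lemma quadratic_nonneg_imp_linear_coeff_zero:
  fixes a b :: real
  assumes "\<And>t. 2 * t * a + t\<^sup>2 * b \<ge> 0"
  shows "a = 0"
proof (rule ccontr)
  assume a: "a \<noteq> 0"
  define s where "s = 1 / (\<bar>b\<bar> + 1)"
  have s: "s > 0" "s * b < 1" by (auto simp: s_def field_simps)
  have "0 \<le> 2 * (- (s * a)) * a + (- (s * a))\<^sup>2 * b" by (rule assms)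
  also have "\<dots> = s * a\<^sup>2 * (s * b - 2)" by (simp add: power2_eq_square algebra_simps)
  also have "\<dots> < 0" using a s by (intro mult_pos_neg) auto
  finally show False by simp
qed

text \<open>The first order condition at a maximum of the form on the unit sphere.\<close>
lemma exists_max_eigenvector:
  fixes f :: "'a::euclidean_space \<Rightarrow> 'a \<Rightarrow> real"
  assumes "bounded_bilinear f" and sym: "\<And>x y. f x y = f y x"
  obtains x \<mu> where "norm x = 1" "\<And>y. f x y = \<mu> * (x \<bullet> y)" "\<And>y. f y y \<le> \<mu> * (y \<bullet> y)"
proof -
  interpret bounded_bilinear f by fact
  obtain b :: 'a where "b \<in> Basis" using nonempty_Basis by blast
  then have "sphere (0::'a) 1 \<noteq> {}" by auto
  moreover have "continuous_on (sphere 0 1) (\<lambda>x. f x x)"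
    by (intro continuous_on continuous_on_id)
  ultimately obtain x where x: "norm x = 1" and max: "\<And>y. norm y = 1 \<Longrightarrow> f y y \<le> f x x"
    using continuous_attains_sup[of "sphere (0::'a) 1" "\<lambda>x. f x x"] by auto
  have bound: "f y y \<le> f x x * (y \<bullet> y)" for y
  proof (cases "y = 0")
    case False
    have "f (y /\<^sub>R norm y) (y /\<^sub>R norm y) \<le> f x x" using False by (intro max) simp
    then have "f y y / (norm y * norm y) \<le> f x x"
      by (simp add: scaleR_left scaleR_right divide_inverse mult_ac)
    then show ?thesis
      using False by (simp add: dot_square_norm power2_eq_square divide_le_eq)
  qed (simp add: zero_left)
  have xx: "x \<bullet> x = 1" using x by (simp add: dot_square_norm)
  have "f x x * (x \<bullet> y) - f x y = 0" for y
  proof (rule quadratic_nonneg_imp_linear_coeff_zero)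
    show "0 \<le> 2 * t * (f x x * (x \<bullet> y) - f x y) + t\<^sup>2 * (f x x * (y \<bullet> y) - f y y)" for t
      using bound[of "x + t *\<^sub>R y"]
      by (simp add: add_left add_right scaleR_left scaleR_right sym[of y x] inner_simps
          xx inner_commute[of y x] power2_eq_square algebra_simps)
  qed
  then show thesis using that[OF x, of "f x x"] bound by simp
qed

text \<open>A polynomial identity of degree at most three in \<open>k\<close> holding at four points has no cubic
  coefficient; here that coefficient is a multiple of \<open>(M - N)\<^sup>3\<close>.\<close>
lemma no_cubic_coefficient:
  fixes M N D C :: real
  assumes "\<And>k. 0 \<le> k \<Longrightarrow> k \<le> 1 \<Longrightarrow>
    (D - (N + k * (M - N))) * (C - (N + k * (M - N))\<^sup>2) = 4 * (k * (1 - k) * (M - N)\<^sup>2)"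
  shows "M = N"
proof -
  define d where "d = M - N"
  define P where
    "P k = (D - (N + k * d)) * (C - (N + k * d)\<^sup>2) - 4 * (k * (1 - k) * d\<^sup>2)" for k
  have "P k = 0" if "0 \<le> k" "k \<le> 1" for k
    using assms[OF that] by (simp add: P_def d_def)
  \<comment> \<open>The third difference with step \<open>1/3\<close> is \<open>6/27\<close> times the cubic coefficient \<open>d\<^sup>3\<close>.\<close>
  moreover have "d ^ 3 = 9 / 2 * (P 1 - 3 * P (2/3) + 3 * P (1/3) - P 0)"
    by (simp add: P_def power2_eq_square power3_eq_cube field_simps)
  ultimately have "d ^ 3 = 0" by simp
  then show ?thesis by (simp add: d_def)
qed

context sphere_form
begin

lemma bounded_bilinear_inner_G: "bounded_bilinear (\<lambda>x y. w \<bullet> G x y)"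
  unfolding bilinear_conv_bounded_bilinear[symmetric] bilinear_def
  by (intro conjI allI linearI) (simp_all add: G_simps inner_simps)

text \<open>Restricting the biharmonic equation to the great circle through two eigenvectors of
  \<open>c \<bullet> F\<close> turns it into a polynomial identity whose leading coefficient is the cube of the
  difference of the eigenvalues, so that all eigenvalues agree. The other two equations come from
  the trace and from the biharmonic equation at an arbitrary point.\<close>
lemma laplacian_component_radial:
  assumes r: "r = 1"
    and eq: "\<And>x. norm x = 1 \<Longrightarrow>
      (real DIM('a) - c \<bullet> G x x) *\<^sub>R (c - (c \<bullet> G x x) *\<^sub>R G x x) = 4 *\<^sub>R gradient_term x"
    and c: "c \<noteq> 0"
    and nonconst: "\<And>w. \<exists>x. norm x = 1 \<and> G x x \<noteq> w"
  shows "c \<bullet> G x y = real DIM('a) * (x \<bullet> y)" and "c \<bullet> c = 2 * (real DIM('a))\<^sup>2"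
proof -
  define f where "f x y = c \<bullet> G x y" for x y
  have f_bil: "bounded_bilinear f"
    using bounded_bilinear_inner_G unfolding f_def .
  have f_sym: "f x y = f y x" for x y
    by (simp add: f_def sym[of y x])
  have scalar_eq: "(real DIM('a) - f x x) * (c \<bullet> c - (f x x)\<^sup>2)
    = 4 * ((\<Sum>b\<in>Basis. (f x b)\<^sup>2) - (f x x)\<^sup>2)" if "norm x = 1" for x
  proof -
    have "c \<bullet> gradient_term x = (\<Sum>b\<in>Basis. (f x b)\<^sup>2) - (f x x)\<^sup>2"
      unfolding gradient_term_def
      by (simp add: inner_diff_right inner_sum_right r power2_eq_square f_def)
    then show ?thesis
      using arg_cong[OF eq[OF that], of "\<lambda>w. c \<bullet> w"]
      by (simp add: inner_diff_right power2_eq_square f_def)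
  qed
  have parseval: "(\<Sum>b\<in>Basis. (w \<bullet> b)\<^sup>2) = w \<bullet> w" for w :: 'a
    using euclidean_inner[of w w] by (simp add: power2_eq_square)
  obtain p M where p: "norm p = 1" "\<And>y. f p y = M * (p \<bullet> y)" "\<And>y. f y y \<le> M * (y \<bullet> y)"
    using exists_max_eigenvector[OF f_bil f_sym] by blast
  have "bounded_bilinear (\<lambda>x y. - f x y)"
    using bounded_bilinear_inner_G[of "- c"] by (simp add: f_def)
  then obtain q N' where q': "norm q = 1" "\<And>y. - f q y = N' * (q \<bullet> y)"
    "\<And>y. - f y y \<le> N' * (y \<bullet> y)"
    using exists_max_eigenvector[of "\<lambda>x y. - f x y"] f_sym by metis
  define N where "N = - N'"
  have q: "norm q = 1" "f q y = N * (q \<bullet> y)" "N * (y \<bullet> y) \<le> f y y" for y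
    using q'(1) q'(2)[of y] q'(3)[of y] by (auto simp: N_def)
  have "M = N"
  proof (rule ccontr)
    assume "M \<noteq> N"
    moreover have "M * (p \<bullet> q) = N * (p \<bullet> q)"
      using p(2)[of q] q(2)[of p] f_sym[of p q] inner_commute[of p q] by metis
    ultimately have pq: "p \<bullet> q = 0" by simp
    have "M = N"
    proof (rule no_cubic_coefficient)
      fix k :: real
      assume k: "0 \<le> k" "k \<le> 1"
      define x where "x = sqrt k *\<^sub>R p + sqrt (1 - k) *\<^sub>R q"
      define w where "w = (M * sqrt k) *\<^sub>R p + (N * sqrt (1 - k)) *\<^sub>R q"
      have fx: "f x y = w \<bullet> y" for y
        using p(2)[of y] q(2)[of y]
        by (simp add: x_def w_def f_def G_simps inner_simps)
      have inners: "p \<bullet> p = 1" "q \<bullet> q = 1" "q \<bullet> p = 0" "p \<bullet> q = 0"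
        using p(1) q(1) pq by (simp_all add: dot_square_norm inner_commute)
      have "x \<bullet> x = 1"
        using k by (simp add: x_def inner_simps inners)
      then have "norm x = 1" by (simp add: norm_eq_sqrt_inner)
      moreover have fxx: "f x x = N + k * (M - N)"
        using k by (simp add: fx) (simp add: w_def x_def inner_simps inners algebra_simps)
      moreover have "w \<bullet> w = k * M\<^sup>2 + (1 - k) * N\<^sup>2"
        using k by (simp add: w_def inner_simps inners power2_eq_square algebra_simps)
      ultimately show "(real DIM('a) - (N + k * (M - N))) * (c \<bullet> c - (N + k * (M - N))\<^sup>2)
        = 4 * (k * (1 - k) * (M - N)\<^sup>2)"
        using scalar_eq[of x] unfolding fxx unfolding fx parseval
        by (simp add: power2_eq_square algebra_simps)
    qed
    with \<open>M \<noteq> N\<close> show False by simp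
  qed
  then have diag: "f y y = M * (y \<bullet> y)" for y
    using p(3)[of y] q(3)[of y] by simp
  have f: "f x y = M * (x \<bullet> y)" for x y
    using diag[of "x + y"] diag[of x] diag[of y] f_sym[of y x]
    by (simp add: f_def G_simps inner_simps inner_commute[of y x] algebra_simps)
  have cc: "c \<bullet> c = 2 * M * real DIM('a)"
  proof -
    have "c \<bullet> c = 2 * (\<Sum>b\<in>Basis. f b b)"
      unfolding f_def inner_sum_right[symmetric] sum_G by simp
    then show ?thesis by (simp add: f)
  qed
  then have M: "M \<noteq> 0" using c by auto
  \<comment> \<open>Otherwise equality in the Cauchy-Schwarz inequality makes \<open>F\<close> constant.\<close>
  have "c \<bullet> c \<noteq> M\<^sup>2"
  proof
    assume *: "c \<bullet> c = M\<^sup>2"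
    obtain x where x: "norm x = 1" "G x x \<noteq> (1 / M) *\<^sub>R c" using nonconst by blast
    have "G x x \<bullet> G x x = 1" "c \<bullet> G x x = M"
      using norm_G[of x] f[of x x] x(1) r by (simp_all add: f_def dot_square_norm)
    then have "(G x x - (1 / M) *\<^sub>R c) \<bullet> (G x x - (1 / M) *\<^sub>R c) = 0"
      using * M by (simp add: inner_simps inner_commute power2_eq_square)
    then show False using x(2) by simp
  qed
  moreover have "(real DIM('a) - M) * (c \<bullet> c - M\<^sup>2) = 0"
    using scalar_eq[OF p(1)] p(1) parseval[of p]
    by (simp add: f power_mult_distrib dot_square_norm flip: sum_distrib_left)
  ultimately have "M = real DIM('a)" by simp
  then show "c \<bullet> G x y = real DIM('a) * (x \<bullet> y)" "c \<bullet> c = 2 * (real DIM('a))\<^sup>2"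
    using f cc by (simp_all add: f_def power2_eq_square)
qed

end

section \<open>Harmonic quadratic forms into the two-sphere\<close>

lemma four_orthogonal_in_dim_3:
  fixes a b c d :: "'a::euclidean_space"
  assumes W: "dim W = 3" "a \<in> W" "b \<in> W" "c \<in> W" "d \<in> W"
    and orth: "a \<bullet> b = 0" "a \<bullet> c = 0" "a \<bullet> d = 0" "b \<bullet> c = 0" "b \<bullet> d = 0" "c \<bullet> d = 0"
    and nz: "a \<noteq> 0" "b \<noteq> 0" "c \<noteq> 0"
  shows "d = 0"
proof (rule ccontr)
  assume d: "d \<noteq> 0"
  have "pairwise orthogonal {a, b, c, d}"
    using orth by (auto simp: pairwise_insert orthogonal_def inner_commute)
  then have "independent {a, b, c, d}"
    using nz d by (intro pairwise_orthogonal_independent) auto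
  then have "card {a, b, c, d} \<le> dim W"
    using W by (intro independent_card_le_dim) auto
  moreover have "card {a, b, c, d} = 4"
    using orth nz d by (auto simp: card_insert_if)
  ultimately show False using W by simp
qed

text \<open>The values lie on the unit sphere of a three-dimensional subspace \<open>W\<close>, so that the
  orthogonal complement of \<open>c\<close> need not be identified with another Euclidean space.\<close>
locale harmonic_two_sphere_form = sphere_form G 1
  for G :: "'a::euclidean_space \<Rightarrow> 'a \<Rightarrow> 'b::euclidean_space" +
  fixes W :: "'b set"
  assumes subspace_W: "subspace W" and dim_W: "dim W = 3" and range_G: "G x y \<in> W"
    and trace_zero: "(\<Sum>b\<in>Basis. G b b) = 0"
begin

lemma trace_zero_orthonormal:
  "orthonormal E \<Longrightarrow> span E = UNIV \<Longrightarrow> (\<Sum>e\<in>E. G e e) = 0"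
  using trace_orthonormal_basis[OF bilinear_G] trace_zero by simp

lemma unit_value: "norm x = 1 \<Longrightarrow> G x x \<bullet> G x x = 1"
  using norm_G[of x] by (simp add: dot_square_norm)

text \<open>On an orthonormal basis \<open>x, y, z\<close> the three unit vectors \<open>G x x\<close>, \<open>G y y\<close>, \<open>G z z\<close> add
  up to zero, hence span a plane and make angles \<open>2 \<pi> / 3\<close> with each other. The polarised
  identities then make \<open>G x y\<close> and \<open>G x z\<close> nonzero, orthogonal to this plane and to each
  other, for which three dimensions are too few.\<close>
lemma domain_dim_not_3: "DIM('a) \<noteq> 3"
proof
  assume dim: "DIM('a) = 3"
  then obtain x y z :: 'a where B: "Basis = {x, y, z}" and distinct: "x \<noteq> y" "x \<noteq> z" "y \<noteq> z"
    by (auto simp: card_3_iff)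
  have inB: "x \<in> Basis" "y \<in> Basis" "z \<in> Basis" using B by auto
  have unit: "norm x = 1" "norm y = 1" "norm z = 1"
    using inB by simp_all
  have inner: "x \<bullet> x = 1" "y \<bullet> y = 1" "z \<bullet> z = 1"
    "x \<bullet> y = 0" "x \<bullet> z = 0" "y \<bullet> z = 0" "y \<bullet> x = 0" "z \<bullet> x = 0" "z \<bullet> y = 0"
    using inB distinct by (simp_all add: inner_Basis)
  have "G x x + G y y + G z z = 0"
    using trace_zero distinct by (simp add: B add.assoc)
  then have Gz: "G z z = - G x x - G y y" by (simp add: algebra_simps eq_neg_iff_add_eq_0)
  have "G z z \<bullet> G z z = 2 + 2 * (G x x \<bullet> G y y)"
    using unit_value[OF unit(1)] unit_value[OF unit(2)]
    by (simp add: Gz inner_simps inner_commute)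
  then have xy: "G x x \<bullet> G y y = - 1/2"
    using unit_value[OF unit(3)] by simp
  have 31: "G x x \<bullet> G x y = 0" "G y y \<bullet> G x y = 0" "G x x \<bullet> G x z = 0" "G z z \<bullet> G x z = 0"
    "G y y \<bullet> G y z = 0" "G z z \<bullet> G y z = 0"
    using polar_31[of x y] polar_31[of y x] polar_31[of x z] polar_31[of z x] polar_31[of y z]
      polar_31[of z y] by (simp_all add: inner sym[of y x] sym[of z x] sym[of z y])
  have yxz: "G y y \<bullet> G x z = 0"
    using 31(3,4) by (simp add: Gz inner_simps)
  have "G x x \<bullet> G y z = 0"
    using 31(5,6) by (simp add: Gz inner_simps)
  then have orth: "G x y \<bullet> G x z = 0"
    using polar_211[of x y z] by (simp add: inner)
  have "G x x \<bullet> G z z = - 1/2"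
    using unit_value[OF unit(1)] xy by (simp add: Gz inner_simps)
  then have nz: "G x y \<noteq> 0" "G x z \<noteq> 0"
    using polar_22[of x y] polar_22[of x z] xy by (auto simp: inner)
  have "G x x \<noteq> 0" using unit_value[OF unit(1)] by auto
  moreover have "G x x + 2 *\<^sub>R G y y \<noteq> 0"
  proof
    assume "G x x + 2 *\<^sub>R G y y = 0"
    then have "(G x x + 2 *\<^sub>R G y y) \<bullet> G y y = 0" by simp
    then show False
      using xy unit_value[OF unit(2)] by (simp add: inner_simps)
  qed
  ultimately have "G x z = 0"
    using 31 yxz orth nz xy unit_value[OF unit(1)] subspace_W
    by (intro four_orthogonal_in_dim_3[OF dim_W, of "G x x" "G x x + 2 *\<^sub>R G y y" "G x y"])
      (auto simp: range_G inner_simps subspace_add subspace_scale)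
  with nz show False by simp
qed

text \<open>The fibre through \<open>x\<close> is the unit sphere of \<open>K = {y. G x y = (x \<bullet> y) G x x}\<close>. The map
  \<open>y \<mapsto> G x y - (x \<bullet> y) G x x\<close> takes values in the plane of \<open>W\<close> orthogonal to \<open>G x x\<close>, so that
  \<open>K\<close> has codimension at most two. On \<open>K\<close> the trace of \<open>G\<close> is \<open>dim K\<close> times a unit vector; it is
  cancelled by at most two further unit vectors.\<close>
lemma fibre_decomposition:
  assumes dim: "DIM('a) \<ge> 3"
  obtains A B v where "orthonormal (A \<union> B)" "A \<inter> B = {}" "span (A \<union> B) = UNIV"
    "card A = 2" "card B = 2" "norm v = 1" "v \<in> W"
    "\<And>y. y \<in> A \<Longrightarrow> G y y = v" "\<And>y. y \<in> B \<Longrightarrow> G y y = - v"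
proof -
  obtain x :: 'a where "x \<in> Basis" using nonempty_Basis by blast
  then have x: "norm x = 1" "x \<bullet> x = 1" by simp_all
  define v where "v = G x x"
  have v: "v \<bullet> v = 1" "norm v = 1" "v \<in> W"
    using unit_value[OF x(1)] range_G by (simp_all add: v_def norm_eq_sqrt_inner)
  define L where "L y = G x y - (x \<bullet> y) *\<^sub>R v" for y
  have lin_L: "linear L"
    by (rule linearI) (simp_all add: L_def G_simps inner_simps algebra_simps)
  define K where "K = {y. L y = 0}"
  have subspace_K: "subspace K"
    unfolding K_def using lin_L by (rule linear_subspace_kernel)
  have on_K: "G y y = v" if "y \<in> K" "norm y = 1" for y
  proof -
    have y: "y \<bullet> y = 1" "G x y = (x \<bullet> y) *\<^sub>R v"
      using that by (simp_all add: K_def L_def dot_square_norm)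
    then have "v \<bullet> G y y = 1"
      using polar_22[of x y] by (simp add: v_def[symmetric] v x power2_eq_square)
    then have "(G y y - v) \<bullet> (G y y - v) = 0"
      using unit_value[OF that(2)] by (simp add: inner_simps v inner_commute)
    then show ?thesis by simp
  qed
  define K' where "K' = {y \<in> UNIV. \<forall>x\<in>K. orthogonal x y}"
  have dim_K': "dim K' + dim K = DIM('a)"
    using dim_subspace_orthogonal_to_vectors[OF subspace_K subspace_UNIV]
    by (simp add: K'_def)
  have subspace_K': "subspace K'"
    unfolding K'_def by (auto intro!: subspaceI simp: orthogonal_clauses)
  have "inj_on L K'"
  proof (rule inj_onI)
    fix y z assume yz: "y \<in> K'" "z \<in> K'" "L y = L z"
    then have "y - z \<in> K" by (simp add: K_def linear_diff[OF lin_L])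
    moreover have "y - z \<in> K'" using yz subspace_K' by (simp add: subspace_diff)
    ultimately show "y = z" by (auto simp: K'_def orthogonal_def)
  qed
  then have "dim (L ` K') = dim K'"
    using lin_L subspace_K' by (intro dim_image_eq) (simp_all add: span_eq_iff[THEN iffD2])
  moreover have "L ` K' \<subseteq> {w \<in> W. \<forall>u\<in>span {v}. orthogonal u w}"
  proof (rule image_subsetI)
    fix y
    have "L y \<in> W"
      using subspace_W range_G v by (simp add: L_def subspace_diff subspace_scale)
    moreover have "v \<bullet> L y = 0"
      using polar_31[of x y] by (simp add: L_def inner_simps v x v_def[symmetric])
    ultimately show "L y \<in> {w \<in> W. \<forall>u\<in>span {v}. orthogonal u w}"
      by (auto simp: span_singleton orthogonal_def)
  qed
  moreover have "dim {w \<in> W. \<forall>u\<in>span {v}. orthogonal u w} = 2"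
  proof -
    have "span {v} \<subseteq> W" using v subspace_W by (simp add: span_minimal)
    moreover have "dim (span {v}) = 1" using v by auto
    ultimately show ?thesis
      using dim_subspace_orthogonal_to_vectors[OF subspace_span subspace_W, of "{v}"] dim_W by simp
  qed
  ultimately have dim_K'_le: "dim K' \<le> 2" by (metis dim_subset)
  obtain A where A: "A \<subseteq> K" "pairwise orthogonal A" "\<And>y. y \<in> A \<Longrightarrow> norm y = 1"
    "independent A" "card A = dim K"
    using orthonormal_basis_subspace[OF subspace_K] by metis
  obtain B where B: "B \<subseteq> K'" "pairwise orthogonal B" "\<And>y. y \<in> B \<Longrightarrow> norm y = 1"
    "independent B" "card B = dim K'"
    using orthonormal_basis_subspace[OF subspace_K'] by metis
  have cross: "a \<bullet> b = 0" if "a \<in> A" "b \<in> B" for a b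
    using that A(1) B(1) by (auto simp: K'_def orthogonal_def)
  then have cross': "b \<bullet> a = 0" if "a \<in> A" "b \<in> B" for a b
    using that by (simp add: inner_commute)
  have disj: "A \<inter> B = {}"
    using cross A(3) by (metis disjoint_iff inner_eq_zero_iff norm_zero zero_neq_one)
  have on: "orthonormal (A \<union> B)"
    using A(2,3) B(2,3) cross cross'
    by (auto simp: orthonormal_def pairwise_def orthogonal_def)
  have fin: "finite A" "finite B" using orthonormal_finite[OF on] by auto
  have card: "card A + card B = DIM('a)" using A(5) B(5) dim_K' by simp
  have span: "span (A \<union> B) = UNIV"
    using orthonormal_independent[OF on] card_Un_disjoint[OF fin disj] card
      card_ge_dim_independent[of "A \<union> B" UNIV] by auto
  have "(\<Sum>y\<in>A. G y y) + (\<Sum>y\<in>B. G y y) = 0"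
    using trace_zero_orthonormal[OF on span] sum.union_disjoint[OF fin disj] by metis
  moreover have "(\<Sum>y\<in>A. G y y) = (\<Sum>y\<in>A. v)"
    using A(1,3) on_K by (intro sum.cong) auto
  ultimately have trace: "real (card A) *\<^sub>R v = - (\<Sum>y\<in>B. G y y)"
    by (simp add: eq_neg_iff_add_eq_0 sum_constant_scaleR)
  have "real (card A) = norm (\<Sum>y\<in>B. G y y)"
    using arg_cong[OF trace, of norm] v by simp
  also have "\<dots> \<le> (\<Sum>y\<in>B. 1)"
    using B(3) by (intro sum_norm_le) (simp add: norm_G)
  finally have "card A \<le> card B" by simp
  then have cards: "card A = 2" "card B = 2"
    using dim_K'_le B(5) card dim domain_dim_not_3 by auto
  \<comment> \<open>Two unit vectors with sum \<open>- 2 v\<close> are both equal to \<open>- v\<close>.\<close>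
  have "G y y = - v" if y: "y \<in> B" for y
  proof -
    obtain z where z: "B = {y, z}" "y \<noteq> z"
      using y cards(2) by (metis card_2_iff doubleton_eq_iff insert_iff singletonD)
    have two_v: "2 *\<^sub>R v = - (G y y + G z z)"
      using trace z cards(1) by simp
    have sum: "G z z = - (2 *\<^sub>R v) - G y y"
      unfolding two_v by simp
    have "G z z \<bullet> G z z = 4 + 4 * (v \<bullet> G y y) + G y y \<bullet> G y y"
      unfolding sum by (simp add: inner_simps v inner_commute)
    then have "v \<bullet> G y y = - 1"
      using unit_value[of y] unit_value[of z] B(3) z y by simp
    then have "(G y y + v) \<bullet> (G y y + v) = 0"
      using unit_value[of y] B(3)[OF y] by (simp add: inner_simps v inner_commute)
    then show ?thesis by (simp add: eq_neg_iff_add_eq_0)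
  qed
  moreover have "G y y = v" if "y \<in> A" for y
    using that A(1,3) on_K by blast
  ultimately show thesis using that[OF on disj span cards v(2,3)] by blast
qed

text \<open>Between \<open>K\<close> and its complement \<open>G\<close> multiplies norms, as complex multiplication does. After
  two frames are fixed and the sign of \<open>y'\<close> is adjusted, the remaining values are forced.\<close>
lemma hopf_frame:
  assumes dim: "DIM('a) \<ge> 3"
  obtains x x' y y' v e e' where
    "x \<bullet> x = 1" "x' \<bullet> x' = 1" "y \<bullet> y = 1" "y' \<bullet> y' = 1"
    "x \<bullet> x' = 0" "x \<bullet> y = 0" "x \<bullet> y' = 0" "x' \<bullet> y = 0" "x' \<bullet> y' = 0" "y \<bullet> y' = 0"
    "v \<bullet> v = 1" "e \<bullet> e = 1" "e' \<bullet> e' = 1" "v \<bullet> e = 0" "v \<bullet> e' = 0" "e \<bullet> e' = 0"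
    "v \<in> W" "e \<in> W" "e' \<in> W"
    "G x x = v" "G x' x' = v" "G y y = - v" "G y' y' = - v" "G x x' = 0" "G y y' = 0"
    "G x y = e" "G x' y' = e" "G x' y = e'" "G x y' = - e'" "DIM('a) = 4"
proof -
  obtain A B v where AB: "orthonormal (A \<union> B)" "A \<inter> B = {}" "span (A \<union> B) = UNIV"
    "card A = 2" "card B = 2" "norm v = 1" "v \<in> W"
    "\<And>y. y \<in> A \<Longrightarrow> G y y = v" "\<And>y. y \<in> B \<Longrightarrow> G y y = - v"
    by (rule fibre_decomposition[OF dim]) blast
  obtain x x' where A: "A = {x, x'}" "x \<noteq> x'" using AB(4) by (auto simp: card_2_iff)
  obtain y z where B: "B = {y, z}" "y \<noteq> z" using AB(5) by (auto simp: card_2_iff)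
  have ne: "x \<noteq> y" "x \<noteq> z" "x' \<noteq> y" "x' \<noteq> z" using AB(2) A B by auto
  have dim4: "DIM('a) = 4"
  proof -
    have "card (A \<union> B) = 4"
      using AB(2,4,5) A B by (subst card_Un_disjoint) auto
    then show ?thesis
      using dim_eq_card[of "A \<union> B" UNIV] AB(3) orthonormal_independent[OF AB(1)] by simp
  qed
  have inner: "x \<bullet> x = 1" "x' \<bullet> x' = 1" "y \<bullet> y = 1" "z \<bullet> z = 1"
    "x \<bullet> x' = 0" "x \<bullet> y = 0" "x \<bullet> z = 0" "x' \<bullet> y = 0" "x' \<bullet> z = 0" "y \<bullet> z = 0"
    using AB(1) A B ne
    by (auto simp: orthonormal_def pairwise_insert orthogonal_def norm_eq_1 inner_commute)
  have v: "v \<bullet> v = 1" using AB(6) by (simp add: dot_square_norm)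
  have G: "G x x = v" "G x' x' = v" "G y y = - v" "G z z = - v"
    using AB(8,9) A B by auto
  have mixed: "G x x' = 0" "G y z = 0"
    using polar_22[of x x'] polar_22[of y z] by (simp_all add: inner G v)
  have norms: "G x y \<bullet> G x y = 1" "G x z \<bullet> G x z = 1" "G x' y \<bullet> G x' y = 1" "G x' z \<bullet> G x' z = 1"
    using polar_22[of x y] polar_22[of x z] polar_22[of x' y] polar_22[of x' z]
    by (simp_all add: inner G v)
  have perp_v: "v \<bullet> G x y = 0" "v \<bullet> G x z = 0" "v \<bullet> G x' y = 0"
    using polar_31[of x y] polar_31[of x z] polar_31[of x' y] by (simp_all add: inner G)
  have perp: "G x y \<bullet> G x' y = 0" "G x y \<bullet> G x z = 0"
    using polar_211[of y x x'] polar_211[of x y z]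
    by (simp_all add: inner inner_commute[of y x] inner_commute[of y x'] G mixed sym[of y x]
        sym[of y x'])
  define e where "e = G x y"
  define e' where "e' = G x' y"
  \<comment> \<open>\<open>W\<close> is three-dimensional, so \<open>G x z\<close> is a multiple \<open>- s e'\<close> of \<open>e'\<close> with \<open>s = 1\<close> or \<open>s = -1\<close>.\<close>
  define s where "s = - (G x z \<bullet> e')"
  have "G x z + s *\<^sub>R e' = 0"
    using perp_v perp norms v subspace_W range_G AB(7)
    by (intro four_orthogonal_in_dim_3[OF dim_W, of v e e'])
      (auto simp: e_def e'_def s_def inner_simps inner_commute
        intro: subspace_diff subspace_add subspace_scale)
  then have xz: "G x z = - s *\<^sub>R e'" by (simp add: eq_neg_iff_add_eq_0)
  then have s: "s * s = 1" using norms by (simp add: e'_def)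
  have e: "e \<bullet> e = 1" "e' \<bullet> e' = 1" "v \<bullet> e = 0" "v \<bullet> e' = 0" "e \<bullet> e' = 0" "e \<in> W" "e' \<in> W"
    using norms perp_v perp range_G by (simp_all add: e_def e'_def)
  define y' where "y' = s *\<^sub>R z"
  have y': "y' \<bullet> y' = 1" "x \<bullet> y' = 0" "x' \<bullet> y' = 0" "y \<bullet> y' = 0" "G y y' = 0" "G y' y' = - v"
    using s inner mixed G by (simp_all add: y'_def G_simps)
  have xy': "G x y' = - e'"
    using xz s by (simp add: y'_def G_simps)
  have "e \<bullet> G x' y' = 1"
    using polar_1111[of x x' y y'] inner y' mixed e
    by (simp add: xy' e_def[symmetric] e'_def[symmetric])
  moreover have "G x' y' \<bullet> G x' y' = 1"
    using norms s by (simp add: y'_def G_simps)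
  ultimately have "(G x' y' - e) \<bullet> (G x' y' - e) = 0"
    using e by (simp add: inner_simps inner_commute)
  then have "G x' y' = e" by simp
  then show thesis
    using that[of x x' y y' v e e'] inner y' v e G mixed xy' AB(7) dim4
    by (simp add: e_def[symmetric] e'_def[symmetric])
qed

end

section \<open>Classification of proper biharmonic quadratic forms into the three-sphere\<close>

lemma quadratic_polarization:
  fixes F :: "'a::euclidean_space \<Rightarrow> 'b::euclidean_space"
  assumes "\<forall>b\<in>Basis. homogeneous_quadratic (\<lambda>x. F x \<bullet> b)"
  obtains G where "bounded_bilinear G" "\<And>x y. G x y = G y x" "\<And>x. F x = G x x"
proof -
  obtain a where a: "\<forall>b\<in>Basis. \<forall>x.
      F x \<bullet> b = (\<Sum>i\<in>Basis. \<Sum>j\<in>Basis. a b i j * (x \<bullet> i) * (x \<bullet> j))"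
    using bchoice[OF assms[unfolded homogeneous_quadratic_def]] by (elim exE)
  define H where
    "H x y = (\<Sum>b\<in>Basis. (\<Sum>i\<in>Basis. \<Sum>j\<in>Basis. a b i j * (x \<bullet> i) * (y \<bullet> j)) *\<^sub>R b)" for x y
  define G where "G x y = (1 / 2) *\<^sub>R (H x y + H y x)" for x y
  have H: "bilinear H"
    unfolding bilinear_def
    by (intro conjI allI linearI)
      (simp_all add: H_def inner_simps algebra_simps sum.distrib sum_distrib_left scaleR_sum_right)
  have "bilinear G"
    unfolding bilinear_def G_def
    by (intro conjI allI linearI) (simp_all add: bilinear_ladd[OF H] bilinear_radd[OF H]
        bilinear_lmul[OF H] bilinear_rmul[OF H] algebra_simps)
  moreover have "F x = G x x" for x
    using euclidean_representation[of "F x"] a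
    by (simp add: G_def H_def flip: scaleR_2)
  ultimately show thesis
    using that[of G] by (simp add: bilinear_conv_bounded_bilinear G_def add.commute)
qed

text \<open>The component of \<open>F\<close> along \<open>c\<close> is constant on the sphere. The component orthogonal to
  \<open>c\<close>, multiplied by \<open>sqrt 2\<close>, is a quadratic form into a unit two-sphere with vanishing
  Laplacian. The homotheties map coordinates to a frame adapted to it: \<open>\<alpha>\<close> to the frame of the
  domain, \<open>\<beta>\<close> to the frame of the target with the direction of \<open>c\<close> as last vector.\<close>
lemma proper_biharmonic_classification:
  fixes \<phi> :: "'a::euclidean_space \<Rightarrow> 'b::euclidean_space"
  assumes dim: "DIM('a) \<ge> 3" "DIM('b) = 4"
    and quad: "quadratic_form_between_spheres \<phi>"
    and biharm: "proper_biharmonic (sphere 0 1) (sphere 0 1) \<phi>"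
  shows "DIM('a) = 4"
    and "\<exists>(\<alpha> :: complex \<times> complex \<Rightarrow> 'a) (\<beta> :: complex \<times> real \<times> real \<Rightarrow> 'b).
      homothetic_transformation (sphere 0 (sqrt 2)) (sphere 0 1) \<alpha> \<and>
      homothetic_transformation (sphere 0 1) (sphere 0 1) \<beta> \<and>
      (\<forall>p\<in>sphere 0 (sqrt 2). \<phi> (\<alpha> p) = \<beta> (hopf_incl p))"
proof -
  obtain F where F: "\<forall>b\<in>Basis. homogeneous_quadratic (\<lambda>x. F x \<bullet> b)"
    "F ` sphere 0 1 \<subseteq> sphere 0 1" "\<forall>x\<in>sphere 0 1. \<phi> x = F x"
    using quad unfolding quadratic_form_between_spheres_def by blast
  obtain G where G: "bounded_bilinear G" "\<And>x y. G x y = G y x" "\<And>x. F x = G x x"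
    using quadratic_polarization[OF F(1)] by blast
  interpret bounded_bilinear G by fact
  have norm_G: "norm (G x x) = (norm x)\<^sup>2" for x
  proof (cases "x = 0")
    case False
    have "F (x /\<^sub>R norm x) \<in> sphere 0 1"
      using False by (intro subsetD[OF F(2) imageI]) simp
    then have "norm (G (x /\<^sub>R norm x) (x /\<^sub>R norm x)) = 1"
      by (simp only: G(3) mem_sphere_0)
    then show ?thesis
      using False by (simp add: scaleR_left scaleR_right power2_eq_square field_simps)
  qed (simp add: zero_left)
  interpret sphere_form_map G 1 \<phi>
    by unfold_locales (use G F(3) norm_G in auto)
  have c: "c \<noteq> 0"
  proof
    assume "c = 0"
    then have "harmonic_map (sphere 0 1) (sphere 0 1) \<phi>"
      using smooth_form tension_form by (simp add: harmonic_map_def)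
    with biharm show False by (simp add: proper_biharmonic_def)
  qed
  have "(real DIM('a) - c \<bullet> G x x) *\<^sub>R (c - (c \<bullet> G x x) *\<^sub>R G x x) = 4 *\<^sub>R gradient_term x"
    if "norm x = 1" for x
    using biharm bitension_form[OF that] that
    by (simp add: proper_biharmonic_def biharmonic_map_def)
  moreover have "\<exists>x. norm x = 1 \<and> G x x \<noteq> w" for w
    using quad \<phi>_eq unfolding quadratic_form_between_spheres_def constant_on_def
    by (metis mem_sphere_0)
  ultimately have radial: "c \<bullet> G x y = real DIM('a) * (x \<bullet> y)" "c \<bullet> c = 2 * (real DIM('a))\<^sup>2"
    for x y
    using laplacian_component_radial[OF refl _ c] by blast+

  define u where "u = (1 / (sqrt 2 * real DIM('a))) *\<^sub>R c"
  have u: "u \<bullet> u = 1"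
    using radial(2) by (simp add: u_def power2_eq_square)
  have uG: "u \<bullet> G x y = (x \<bullet> y) / sqrt 2" for x y
    by (simp add: u_def radial(1))
  define H where "H x y = sqrt 2 *\<^sub>R G x y - (x \<bullet> y) *\<^sub>R u" for x y
  have GH: "G x y = (1 / sqrt 2) *\<^sub>R (H x y + (x \<bullet> y) *\<^sub>R u)" for x y
    by (simp add: H_def)
  have "bilinear H"
    unfolding bilinear_def
    by (intro conjI allI linearI) (simp_all add: H_def G_simps inner_simps algebra_simps)
  then interpret H: bounded_bilinear H by (simp add: bilinear_conv_bounded_bilinear)
  define W where "W = {w. u \<bullet> w = 0}"
  interpret H: harmonic_two_sphere_form H W
  proof
    show "norm (H x x) = (norm x)\<^sup>2 / 1\<^sup>2" for x
    proof -
      have "G x x \<bullet> G x x = (x \<bullet> x)\<^sup>2"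
        using norm_G[of x] by (simp flip: power2_norm_eq_inner)
      moreover have "G x x \<bullet> u = (x \<bullet> x) / sqrt 2"
        using uG[of x x] by (simp add: inner_commute)
      moreover have "sqrt 2 * (sqrt 2 * a - a / sqrt 2) = a" for a
        by (simp add: field_simps)
      ultimately have "H x x \<bullet> H x x = (x \<bullet> x)\<^sup>2"
        by (simp add: H_def inner_simps uG u power2_eq_square)
      then have "(norm (H x x))\<^sup>2 = ((norm x)\<^sup>2)\<^sup>2"
        by (simp only: power2_norm_eq_inner)
      then have "norm (H x x) = (norm x)\<^sup>2"
        by (rule power2_eq_imp_eq) simp_all
      then show ?thesis by simp
    qed
    show "H x y = H y x" for x y
      by (simp add: H_def inner_commute G(2)[of x y])
    show "subspace W" unfolding W_def by (rule subspace_hyperplane)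
    have "u \<noteq> 0" using u by auto
    then show "dim W = 3" unfolding W_def using dim_hyperplane[of u] dim by simp
    show "H x y \<in> W" for x y
      by (simp add: W_def H_def inner_simps uG u)
    have "(\<Sum>b\<in>Basis. H b b) = sqrt 2 *\<^sub>R (\<Sum>b\<in>Basis. G b b) - real DIM('a) *\<^sub>R u"
      by (simp add: H_def sum_subtractf scaleR_sum_right sum_constant_scaleR)
    also have "\<dots> = 0"
      by (simp add: sum_G u_def field_simps)
    finally show "(\<Sum>b\<in>Basis. H b b) = 0" .
  qed simp_all

  obtain x x' y y' v e e' where
    inner: "x \<bullet> x = 1" "x' \<bullet> x' = 1" "y \<bullet> y = 1" "y' \<bullet> y' = 1"
    "x \<bullet> x' = 0" "x \<bullet> y = 0" "x \<bullet> y' = 0" "x' \<bullet> y = 0" "x' \<bullet> y' = 0" "y \<bullet> y' = 0"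
    "v \<bullet> v = 1" "e \<bullet> e = 1" "e' \<bullet> e' = 1" "v \<bullet> e = 0" "v \<bullet> e' = 0" "e \<bullet> e' = 0"
    and W: "v \<in> W" "e \<in> W" "e' \<in> W"
    and H: "H x x = v" "H x' x' = v" "H y y = - v" "H y' y' = - v" "H x x' = 0" "H y y' = 0"
    "H x y = e" "H x' y' = e" "H x' y = e'" "H x y' = - e'"
    and dim4: "DIM('a) = 4"
    by (rule H.hopf_frame[OF dim(1)]) blast
  show "DIM('a) = 4" by (rule dim4)
  have inner_u: "u \<bullet> v = 0" "u \<bullet> e = 0" "u \<bullet> e' = 0"
    using W by (simp_all add: W_def)
  define \<alpha> where "\<alpha> p = (1 / sqrt 2) *\<^sub>R (Re (fst p) *\<^sub>R x + Im (fst p) *\<^sub>R x'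
    + Re (snd p) *\<^sub>R y + Im (snd p) *\<^sub>R y')" for p :: "complex \<times> complex"
  define \<beta> where "\<beta> q = Re (fst q) *\<^sub>R e + Im (fst q) *\<^sub>R e' + fst (snd q) *\<^sub>R v
    + snd (snd q) *\<^sub>R u" for q :: "complex \<times> real \<times> real"
  have \<alpha>_inner: "\<alpha> p \<bullet> \<alpha> q = 1 / 2 * (p \<bullet> q)" for p q
    by (simp add: \<alpha>_def inner_simps inner inner_commute[of x' x] inner_commute[of y x]
        inner_commute[of y x'] inner_commute[of y' x] inner_commute[of y' x']
        inner_commute[of y' y] inner_prod_def inner_complex_def field_simps)
  have \<beta>_inner: "\<beta> p \<bullet> \<beta> q = 1 * (p \<bullet> q)" for p q
    by (simp add: \<beta>_def inner_simps inner inner_u u inner_commute[of e v] inner_commute[of e' v]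
        inner_commute[of e' e] inner_commute[of v u] inner_commute[of e u]
        inner_commute[of e' u] inner_prod_def inner_complex_def)
  have "linear \<alpha>" "linear \<beta>"
    by (auto intro!: linearI simp: \<alpha>_def \<beta>_def algebra_simps)
  have halves: "(a / 2) *\<^sub>R w + (a / 2) *\<^sub>R w = a *\<^sub>R w"
    "(a / 2) *\<^sub>R w + ((a / 2) *\<^sub>R w + w') = a *\<^sub>R w + w'" for a and w w' :: 'b
    by (simp_all flip: scaleR_add_left add.assoc)
  have "homothetic_transformation (sphere 0 (sqrt 2)) (sphere 0 (sqrt (1 / 2) * sqrt 2)) \<alpha>"
    using \<open>linear \<alpha>\<close> \<alpha>_inner dim4 by (intro homothetic_transformation_linear) auto
  moreover have "homothetic_transformation (sphere 0 1) (sphere 0 (sqrt 1 * 1)) \<beta>"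
    using \<open>linear \<beta>\<close> \<beta>_inner dim by (intro homothetic_transformation_linear) auto
  moreover have "\<phi> (\<alpha> p) = \<beta> (hopf_incl p)" if p: "norm p = sqrt 2" for p
  proof -
    have "p \<bullet> p = 2" using p by (simp add: dot_square_norm)
    then have "norm (\<alpha> p) = 1" by (simp add: norm_eq_sqrt_inner \<alpha>_inner)
    then have "\<phi> (\<alpha> p) = G (\<alpha> p) (\<alpha> p)" by (rule \<phi>_eq)
    also have "\<dots> = (1 / sqrt 2) *\<^sub>R (H (\<alpha> p) (\<alpha> p) + ((p \<bullet> p) / 2) *\<^sub>R u)"
      by (simp add: GH \<alpha>_inner)
    also have "H (\<alpha> p) (\<alpha> p) = (1 / 2) *\<^sub>R (2 * Re (fst p * cnj (snd p))) *\<^sub>R e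
      + (1 / 2) *\<^sub>R (2 * Im (fst p * cnj (snd p))) *\<^sub>R e'
      + (1 / 2) *\<^sub>R (fst p \<bullet> fst p - snd p \<bullet> snd p) *\<^sub>R v"
      by (simp add: halves \<alpha>_def H.G_simps H H.sym[of x' x] H.sym[of y x] H.sym[of y x']
          H.sym[of y' x] H.sym[of y' x'] H.sym[of y' y] inner_complex_def algebra_simps
          power2_eq_square)
    also have "(1 / sqrt 2) *\<^sub>R (\<dots> + ((p \<bullet> p) / 2) *\<^sub>R u) = \<beta> (hopf_form p p)"
      by (simp add: \<beta>_def hopf_form_def algebra_simps)
    finally show ?thesis by (simp add: hopf_incl_eq)
  qed
  ultimately show "\<exists>(\<alpha> :: complex \<times> complex \<Rightarrow> 'a) (\<beta> :: complex \<times> real \<times> real \<Rightarrow> 'b).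
      homothetic_transformation (sphere 0 (sqrt 2)) (sphere 0 1) \<alpha> \<and>
      homothetic_transformation (sphere 0 1) (sphere 0 1) \<beta> \<and>
      (\<forall>p\<in>sphere 0 (sqrt 2). \<phi> (\<alpha> p) = \<beta> (hopf_incl p))"
    by (intro exI[of _ \<alpha>] exI[of _ \<beta>]) (simp add: real_sqrt_mult[symmetric])
qed

theorem theorem4p11:
  shows "proper_biharmonic (sphere 0 (sqrt 2)) (sphere 0 1) hopf_incl \<and>
    quadratic_form_between_spheres (\<lambda>x. hopf_incl (sqrt 2 *\<^sub>R x)) \<and>
    (\<forall>(m::nat) (\<phi> :: real ^ 'n \<Rightarrow> real ^ 4).
       m \<ge> 2 \<longrightarrow> CARD('n) = m + 1 \<longrightarrow>
       quadratic_form_between_spheres \<phi> \<longrightarrow>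
       proper_biharmonic (sphere 0 1) (sphere 0 1) \<phi> \<longrightarrow>
       m = 3 \<and>
       (\<exists>(\<alpha> :: complex \<times> complex \<Rightarrow> real ^ 'n) (\<beta> :: complex \<times> real \<times> real \<Rightarrow> real ^ 4).
          homothetic_transformation (sphere 0 (sqrt 2)) (sphere 0 1) \<alpha> \<and>
          homothetic_transformation (sphere 0 1) (sphere 0 1) \<beta> \<and>
          (\<forall>p\<in>sphere 0 (sqrt 2). \<phi> (\<alpha> p) = \<beta> (hopf_incl p))))"
proof (intro conjI allI impI)
  fix m :: nat and \<phi> :: "real ^ 'n \<Rightarrow> real ^ 4"
  assume m: "m \<ge> 2" "CARD('n) = m + 1"
    and \<phi>: "quadratic_form_between_spheres \<phi>" "proper_biharmonic (sphere 0 1) (sphere 0 1) \<phi>"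
  have dims: "DIM(real ^ 'n) \<ge> 3" "DIM(real ^ 4) = 4" using m by simp_all
  show "m = 3" using proper_biharmonic_classification(1)[OF dims \<phi>] m by simp
  show "\<exists>(\<alpha> :: complex \<times> complex \<Rightarrow> real ^ 'n) (\<beta> :: complex \<times> real \<times> real \<Rightarrow> real ^ 4).
      homothetic_transformation (sphere 0 (sqrt 2)) (sphere 0 1) \<alpha> \<and>
      homothetic_transformation (sphere 0 1) (sphere 0 1) \<beta> \<and>
      (\<forall>p\<in>sphere 0 (sqrt 2). \<phi> (\<alpha> p) = \<beta> (hopf_incl p))"
    by (rule proper_biharmonic_classification(2)[OF dims \<phi>])
qed (rule proper_biharmonic_hopf_incl quadratic_form_hopf_incl)+

end
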